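(* Let $G$ be a finitely generated free group. The language of an SFT on $G$ is decidable: there is an algorithm that, given a finite set of forbidden patterns defining an SFT $X\subset A^G$ and a finite pattern $P$, decides whether $P$ occurs in $X$. In particular, given two SFTs $X,Y$ on $G$ (by finite sets of forbidden patterns), it is decidable whether $X\subset Y$.
   Context: $A$ is a finite alphabet, $G$ acts on $A^G$ by $(gx)_h=x_{g^{-1}h}$. A pattern is $P\in A^D$ with $D\subset G$ finite; it occurs in $x\in A^G$ if for some $g\in G$, $x_{gh}=P_h$ for all $h\in D$. The SFT defined by a finite set $\mathcal P$ of forbidden patterns is the set of $x\in A^G$ in which no $P\in\mathcal P$ occurs. The language of $X$ is the set of patterns that occur in some $x\in X$. *)

theory Defs
  imports "HOL-Algebra.Generated_Groups" "HOL-Library.Nat_Bijection" "HOL-Library.FuncSet"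
begin

text \<open>A letter \<open>(x, b)\<close> stands for the formal symbol \<open>x\<close> if \<open>b\<close> is \<open>False\<close> and for its formal
  inverse if \<open>b\<close> is \<open>True\<close>; \<open>v\<close> assigns group elements to the symbols.\<close>

type_synonym 'b word = "('b \<times> bool) list"

definition letter_value :: "('g, 'm) monoid_scheme \<Rightarrow> ('b \<Rightarrow> 'g) \<Rightarrow> 'b \<times> bool \<Rightarrow> 'g" where
  "letter_value G v l = (if snd l then inv\<^bsub>G\<^esub> (v (fst l)) else v (fst l))"

definition word_value :: "('g, 'm) monoid_scheme \<Rightarrow> ('b \<Rightarrow> 'g) \<Rightarrow> 'b word \<Rightarrow> 'g" where
  "word_value G v w = foldr (\<lambda>l g. letter_value G v l \<otimes>\<^bsub>G\<^esub> g) w \<one>\<^bsub>G\<^esub>"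

definition reduced :: "'b word \<Rightarrow> bool" where
  "reduced w \<longleftrightarrow> successively (\<lambda>l m. \<not> (fst l = fst m \<and> snd l \<noteq> snd m)) w"

text \<open>Every group element is the value of exactly one reduced word over the basis. The basis may
  be infinite.\<close>

definition free_basis :: "('g, 'm) monoid_scheme \<Rightarrow> 'g set \<Rightarrow> bool" where
  "free_basis G B \<longleftrightarrow> B \<subseteq> carrier G \<and>
     bij_betw (word_value G (\<lambda>b. b)) {w \<in> lists (B \<times> UNIV). reduced w} (carrier G)"

definition free_group :: "('g, 'm) monoid_scheme \<Rightarrow> bool" where
  "free_group G \<longleftrightarrow> group G \<and> (\<exists>B. free_basis G B)"

text \<open>A pattern \<open>P \<in> A\<^sup>D\<close> is a partial map with domain \<open>D\<close>. Configurations are the functions in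
  \<open>carrier G \<rightarrow>\<^sub>E A\<close>.\<close>

definition pattern :: "('g, 'm) monoid_scheme \<Rightarrow> 'a set \<Rightarrow> ('g \<rightharpoonup> 'a) \<Rightarrow> bool" where
  "pattern G A P \<longleftrightarrow> finite (dom P) \<and> dom P \<subseteq> carrier G \<and> ran P \<subseteq> A"

definition occurs :: "('g, 'm) monoid_scheme \<Rightarrow> ('g \<rightharpoonup> 'a) \<Rightarrow> ('g \<Rightarrow> 'a) \<Rightarrow> bool" where
  "occurs G P x \<longleftrightarrow> (\<exists>g\<in>carrier G. \<forall>h\<in>dom P. P h = Some (x (g \<otimes>\<^bsub>G\<^esub> h)))"

definition SFT :: "('g, 'm) monoid_scheme \<Rightarrow> 'a set \<Rightarrow> ('g \<rightharpoonup> 'a) set \<Rightarrow> ('g \<Rightarrow> 'a) set" where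
  "SFT G A F = {x \<in> carrier G \<rightarrow>\<^sub>E A. \<forall>P\<in>F. \<not> occurs G P x}"

definition language :: "('g, 'm) monoid_scheme \<Rightarrow> 'a set \<Rightarrow> ('g \<Rightarrow> 'a) set \<Rightarrow> ('g \<rightharpoonup> 'a) set" where
  "language G A X = {P. pattern G A P \<and> (\<exists>x\<in>X. occurs G P x)}"

datatype recf = Zero | Succ | Proj nat | Comp recf "recf list" | PrimRec recf recf | Mu recf

text \<open>\<open>computes f xs y\<close>: the program \<open>f\<close> halts on the arguments \<open>xs\<close> with result \<open>y\<close>. The step
  function of a primitive recursion receives the counter, the previous value and the parameters,
  in this order; minimization searches over the first argument.\<close>

inductive computes :: "recf \<Rightarrow> nat list \<Rightarrow> nat \<Rightarrow> bool" where
  zero: "computes Zero xs 0"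
| succ: "computes Succ [x] (Suc x)"
| proj: "i < length xs \<Longrightarrow> computes (Proj i) xs (xs ! i)"
| comp: "list_all2 (\<lambda>g y. computes g xs y) gs ys \<Longrightarrow> computes f ys z \<Longrightarrow> computes (Comp f gs) xs z"
| rec_0: "computes f xs y \<Longrightarrow> computes (PrimRec f g) (0 # xs) y"
| rec_Suc: "computes (PrimRec f g) (n # xs) y \<Longrightarrow> computes g (n # y # xs) z \<Longrightarrow>
    computes (PrimRec f g) (Suc n # xs) z"
| mu: "computes f (n # xs) 0 \<Longrightarrow> (\<And>m. m < n \<Longrightarrow> \<exists>y. computes f (m # xs) (Suc y)) \<Longrightarrow>
    computes (Mu f) xs n"

lemma computes_deterministic: "computes f xs y \<Longrightarrow> computes f xs z \<Longrightarrow> y = z"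
proof (induction arbitrary: z rule: computes.induct)
  case (zero xs)
  then show ?case by cases simp
next
  case (succ x)
  then show ?case by cases simp
next
  case (proj i xs)
  from proj(2) show ?case by cases simp
next
  case (comp xs gs ys f y)
  from comp.prems obtain ys' where ys': "list_all2 (\<lambda>g y. computes g xs y) gs ys'" "computes f ys' z"
    by cases simp
  have "ys = ys'"
  proof (rule nth_equalityI)
    show "length ys = length ys'"
      using comp.IH(1) ys'(1) by (simp add: list_all2_conv_all_nth)
    show "ys ! i = ys' ! i" if "i < length ys" for i
      using comp.IH(1) ys'(1) that unfolding list_all2_conv_all_nth by metis
  qed
  with comp.IH(2) ys'(2) show ?case by simp
next
  case (rec_0 f xs y g)
  from rec_0.prems show ?case by cases (use rec_0.IH in simp_all)
next
  case (rec_Suc f g n xs y y')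
  from rec_Suc.prems obtain u where "computes (PrimRec f g) (n # xs) u" "computes g (n # u # xs) z"
    by cases simp_all
  with rec_Suc.IH show ?case by metis
next
  case (mu f n xs)
  from mu.prems have z: "computes f (z # xs) 0" "\<And>m. m < z \<Longrightarrow> \<exists>y. computes f (m # xs) (Suc y)"
    by (cases; simp)+
  show ?case
  proof (rule linorder_cases)
    assume "n < z"
    with z(2) mu.IH(1) show ?thesis by (metis nat.distinct(1))
  next
    assume "z < n"
    with z(1) mu.IH(2) show ?thesis by (metis nat.distinct(1))
  qed
qed

definition decidable :: "nat set \<Rightarrow> bool" where
  "decidable S \<longleftrightarrow> (\<exists>f. \<forall>n. computes f [n] (if n \<in> S then 1 else 0))"

text \<open>Given a list \<open>gs\<close> of generators of \<open>G\<close> and a list \<open>syms\<close> of the symbols of the alphabet, a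
  pattern is presented by a list of pairs of a word over the generators (not necessarily reduced)
  and the index of a symbol. As the graph of a partial map is functional, a list assigning two
  different symbols to the same group element presents no pattern.\<close>

type_synonym pattern_pres = "(nat word \<times> nat) list"

definition presents ::
    "('g, 'm) monoid_scheme \<Rightarrow> 'g list \<Rightarrow> 'a list \<Rightarrow> pattern_pres \<Rightarrow> ('g \<rightharpoonup> 'a) \<Rightarrow> bool" where
  "presents G gs syms p P \<longleftrightarrow>
     (\<forall>(w, i)\<in>set p. w \<in> lists ({..<length gs} \<times> UNIV) \<and> i < length syms) \<and>
     Map.graph P = (\<lambda>(w, i). (word_value G ((!) gs) w, syms ! i)) ` set p"

definition letter_code :: "nat \<times> bool \<Rightarrow> nat" where
  "letter_code l = 2 * fst l + (if snd l then 1 else 0)"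

definition word_code :: "nat word \<Rightarrow> nat" where
  "word_code w = list_encode (map letter_code w)"

definition pattern_code :: "pattern_pres \<Rightarrow> nat" where
  "pattern_code p = list_encode (map (\<lambda>(w, i). prod_encode (word_code w, i)) p)"

definition patterns_code :: "pattern_pres list \<Rightarrow> nat" where
  "patterns_code ps = list_encode (map pattern_code ps)"

definition language_problem :: "('g, 'm) monoid_scheme \<Rightarrow> 'a set \<Rightarrow> 'g list \<Rightarrow> 'a list \<Rightarrow> nat set" where
  "language_problem G A gs syms =
     {prod_encode (patterns_code fs, pattern_code p) | fs p Fs P.
        list_all2 (presents G gs syms) fs Fs \<and> presents G gs syms p P \<and>
        P \<in> language G A (SFT G A (set Fs))}"

definition inclusion_problem :: "('g, 'm) monoid_scheme \<Rightarrow> 'a set \<Rightarrow> 'g list \<Rightarrow> 'a list \<Rightarrow> nat set" where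
  "inclusion_problem G A gs syms =
     {prod_encode (patterns_code fs, patterns_code hs) | fs hs Fs Hs.
        list_all2 (presents G gs syms) fs Fs \<and> list_all2 (presents G gs syms) hs Hs \<and>
        SFT G A (set Fs) \<subseteq> SFT G A (set Hs)}"

end

theory Submission
  imports Defs
begin

text \<open>Fix a finite basis of the free group and write the elements as reduced words. Let \<open>B\<close> be the
  finite set of all suffixes of the words that occur in the given patterns, together with the
  empty word. A configuration \<open>x\<close> of the SFT shows at each \<open>g\<close> the colouring \<open>h \<mapsto> x (g h)\<close> of \<open>B\<close>.
  None of these colourings has a forbidden pattern at the identity, and for each letter \<open>c\<close> the
  colourings seen at \<open>g\<close> and at \<open>g c\<close> agree where they overlap (\<open>extendable_if_occurs\<close>).

  Conversely, let \<open>S\<close> be a set of colourings of \<open>B\<close> without a forbidden pattern at the identity,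
  in which every member has an agreeing neighbour in \<open>S\<close> for every letter. Then every member of
  \<open>S\<close> is seen at the identity in some configuration of the SFT: walk outwards from the identity
  and choose neighbours in \<open>S\<close>. The Cayley graph is a tree, so each element is reached along one
  path only and the choices never conflict. Agreement of neighbours propagates along the words in
  \<open>B\<close>, which is closed under suffixes, so the colouring chosen at \<open>g\<close> is the one that the
  resulting configuration shows there (\<open>occurs_if_extendable\<close>).

  Hence a pattern is in the language if and only if it fits a member of the greatest such set \<open>S\<close>.
  This set is found by starting with the finitely many colourings without a forbidden pattern and
  deleting those that lack a neighbour until nothing changes (\<open>stabilize_greatest\<close>,
  \<open>refine_stabilize\<close>). One SFT is contained in another if and only if no forbidden pattern of the
  second is in the language of the first.

  The given generators need not be a basis. A finite table of their values as words in the basis,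
  followed by free reduction, decides which words over the generators are equal in the group. This
  is also what tells whether a list of pairs presents a pattern at all.

  The algorithm is written with ordinary functions on numbers, pairs and lists. These types are in
  bijection with the natural numbers through the codes of the problem, and the functions whose
  counterparts on codes are computed by a program are closed under the usual constructions on
  lists, bounded quantifiers included. By \<open>decidable_if_computable_pred\<close> it is then enough to
  describe the two sets of codes by such functions.\<close>

section \<open>Recursive functions of fixed arity\<close>

definition recursive :: "nat \<Rightarrow> (nat list \<Rightarrow> nat) \<Rightarrow> bool" where
  "recursive k f \<longleftrightarrow> (\<exists>p. \<forall>xs. length xs = k \<longrightarrow> computes p xs (f xs))"

lemma recursive_cong:
  assumes "\<And>xs. length xs = k \<Longrightarrow> f xs = g xs" and "recursive k f"
  shows "recursive k g"
  using assms unfolding recursive_def by metis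

lemma recursive_proj: "i < k \<Longrightarrow> recursive k (\<lambda>xs. xs ! i)"
  unfolding recursive_def by (metis computes.proj)

lemma recursive_comp:
  assumes h: "recursive (length fs) h" and fs: "\<And>f. f \<in> set fs \<Longrightarrow> recursive k f"
  shows "recursive k (\<lambda>xs. h (map (\<lambda>f. f xs) fs))"
proof -
  obtain p where p: "\<And>ys. length ys = length fs \<Longrightarrow> computes p ys (h ys)"
    using h unfolding recursive_def by blast
  obtain q where q: "\<And>f xs. f \<in> set fs \<Longrightarrow> length xs = k \<Longrightarrow> computes (q f) xs (f xs)"
    using fs unfolding recursive_def by metis
  have "computes (Comp p (map q fs)) xs (h (map (\<lambda>f. f xs) fs))" if "length xs = k" for xs
  proof (rule computes.comp)
    show "list_all2 (\<lambda>g y. computes g xs y) (map q fs) (map (\<lambda>f. f xs) fs)"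
      using q that by (simp add: list_all2_conv_all_nth)
    show "computes p (map (\<lambda>f. f xs) fs) (h (map (\<lambda>f. f xs) fs))"
      by (rule p) simp
  qed
  then show ?thesis
    unfolding recursive_def by blast
qed

lemma recursive_comp1:
  assumes "recursive 1 (\<lambda>xs. h (xs ! 0))" "recursive k f"
  shows "recursive k (\<lambda>xs. h (f xs))"
  using recursive_comp[of "[f]" "\<lambda>xs. h (xs ! 0)" k] assms by simp

lemma recursive_Suc: "recursive k f \<Longrightarrow> recursive k (\<lambda>xs. Suc (f xs))"
proof (rule recursive_comp1[where h = Suc])
  have "computes Succ xs (Suc (xs ! 0))" if "length xs = 1" for xs
    using that by (auto simp: length_Suc_conv intro: computes.succ)
  then show "recursive 1 (\<lambda>xs. Suc (xs ! 0))"
    unfolding recursive_def by blast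
qed

lemma recursive_const: "recursive k (\<lambda>_. c)"
proof (induction c)
  case 0
  show ?case
    unfolding recursive_def by (metis computes.zero)
next
  case (Suc c)
  then show ?case
    by (rule recursive_Suc)
qed

lemma recursive_prim:
  assumes a: "recursive k a" and g: "recursive (k + 2) g"
  shows "recursive (Suc k) (\<lambda>ys. rec_nat (a (tl ys)) (\<lambda>i y. g (i # y # tl ys)) (hd ys))"
proof -
  obtain p where p: "\<And>xs. length xs = k \<Longrightarrow> computes p xs (a xs)"
    using a unfolding recursive_def by blast
  obtain q where q: "\<And>xs. length xs = k + 2 \<Longrightarrow> computes q xs (g xs)"
    using g unfolding recursive_def by blast
  have "computes (PrimRec p q) (n # xs) (rec_nat (a xs) (\<lambda>i y. g (i # y # xs)) n)"
    if "length xs = k" for n xs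
  proof (induction n)
    case 0
    show ?case
      using p that by (auto intro: computes.rec_0)
  next
    case (Suc n)
    then show ?case
      using q that by (auto intro!: computes.rec_Suc)
  qed
  then have "computes (PrimRec p q) ys (rec_nat (a (tl ys)) (\<lambda>i y. g (i # y # tl ys)) (hd ys))"
    if "length ys = Suc k" for ys
    using that by (cases ys) auto
  then show ?thesis
    unfolding recursive_def by blast
qed

lemma recursive_rec_nat:
  assumes n: "recursive k n" and a: "recursive k a" and g: "recursive (k + 2) g"
  shows "recursive k (\<lambda>xs. rec_nat (a xs) (\<lambda>i y. g (i # y # xs)) (n xs))"
proof -
  let ?h = "\<lambda>ys. rec_nat (a (tl ys)) (\<lambda>i y. g (i # y # tl ys)) (hd ys)"
  let ?fs = "n # map (\<lambda>i xs. xs ! i) [0..<k]"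
  have "recursive k (\<lambda>xs. ?h (map (\<lambda>f. f xs) ?fs))"
    using n recursive_prim[OF a g] by (intro recursive_comp) (auto intro: recursive_proj)
  moreover have "map (\<lambda>f. f xs) ?fs = n xs # xs" if "length xs = k" for xs
    using that by (auto simp: comp_def intro: nth_equalityI)
  ultimately show ?thesis
    by (auto elim!: recursive_cong[rotated])
qed

lemma recursive_Least:
  assumes f: "recursive (Suc k) f" and ex: "\<And>xs. length xs = k \<Longrightarrow> \<exists>n. f (n # xs) = 0"
  shows "recursive k (\<lambda>xs. LEAST n. f (n # xs) = 0)"
proof -
  obtain p where p: "\<And>xs. length xs = Suc k \<Longrightarrow> computes p xs (f xs)"
    using f unfolding recursive_def by blast
  have "computes (Mu p) xs (LEAST n. f (n # xs) = 0)" if len: "length xs = k" for xs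
  proof (rule computes.mu)
    show "computes p ((LEAST n. f (n # xs) = 0) # xs) 0"
      using p[of "(LEAST n. f (n # xs) = 0) # xs"] LeastI_ex[OF ex[OF len]] len by simp
    show "\<exists>y. computes p (m # xs) (Suc y)" if "m < (LEAST n. f (n # xs) = 0)" for m
      using p[of "m # xs"] not_less_Least[OF that] len by (metis length_Cons not0_implies_Suc)
  qed
  then show ?thesis
    unfolding recursive_def by blast
qed

lemma recursive_add:
  assumes "recursive k f" "recursive k g"
  shows "recursive k (\<lambda>xs. f xs + g xs)"
proof -
  have "rec_nat b (\<lambda>i y. Suc y) a = a + b" for a b :: nat
    by (induction a) auto
  with recursive_rec_nat[OF assms recursive_Suc[OF recursive_proj[of 1 "k + 2"]]] show ?thesis
    by simp
qed

lemma recursive_diff: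
  assumes "recursive k f" "recursive k g"
  shows "recursive k (\<lambda>xs. f xs - g xs)"
proof -
  have "rec_nat 0 (\<lambda>i y. i) a = a - 1" for a :: nat
    by (induction a) auto
  with recursive_rec_nat[OF recursive_proj[of 1 "k + 2"] recursive_const[of _ 0]
      recursive_proj[of 0 "k + 2 + 2"]]
  have pred: "recursive (k + 2) (\<lambda>xs. xs ! 1 - 1)"
    by simp
  have "rec_nat a (\<lambda>i y. y - 1) b = a - b" for a b :: nat
    by (induction b) auto
  with recursive_rec_nat[OF assms(2,1) pred] show ?thesis
    by simp
qed

lemma recursive_triangle:
  assumes "recursive k f"
  shows "recursive k (\<lambda>xs. triangle (f xs))"
proof -
  have step: "recursive (k + 2) (\<lambda>xs. xs ! 1 + Suc (xs ! 0))"
    by (intro recursive_add recursive_Suc recursive_proj) auto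
  have "rec_nat 0 (\<lambda>i y. y + Suc i) n = triangle n" for n
    by (induction n) auto
  with recursive_rec_nat[OF assms recursive_const[of _ 0] step] show ?thesis
    by simp
qed

lemma recursive_prod_encode:
  assumes "recursive k f" "recursive k g"
  shows "recursive k (\<lambda>xs. prod_encode (f xs, g xs))"
  unfolding prod_encode_def prod.case
  by (intro recursive_add recursive_triangle assms)

lemma triangle_mono: "m \<le> n \<Longrightarrow> triangle m \<le> triangle n"
  by (induction n) (auto simp: le_Suc_eq)

text \<open>A pair lies on the diagonal given by the sum of its components. Its code determines the
  diagonal as the one whose successor has the first triangle number above the code, so a search
  finds it; the components are differences then.\<close>

lemma Least_diagonal: "(LEAST t. Suc (prod_encode (a, b)) - triangle (Suc t) = 0) = a + b"
proof (rule Least_equality)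
  show "Suc (prod_encode (a, b)) - triangle (Suc (a + b)) = 0"
    by (simp add: prod_encode_def)
  fix t
  assume t: "Suc (prod_encode (a, b)) - triangle (Suc t) = 0"
  show "a + b \<le> t"
  proof (rule ccontr)
    assume "\<not> a + b \<le> t"
    then have "triangle (Suc t) \<le> triangle (a + b)"
      by (intro triangle_mono) simp
    with t show False
      by (simp add: prod_encode_def)
  qed
qed

lemma recursive_prod_decode:
  assumes "recursive k f"
  shows "recursive k (\<lambda>xs. fst (prod_decode (f xs)))" "recursive k (\<lambda>xs. snd (prod_decode (f xs)))"
proof -
  define d where "d = (\<lambda>n. LEAST t. Suc n - triangle (Suc t) = 0)"
  have d: "d n = fst (prod_decode n) + snd (prod_decode n)" for n
    using Least_diagonal[of "fst (prod_decode n)" "snd (prod_decode n)"]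
    unfolding d_def by simp
  have "recursive (Suc 1) (\<lambda>xs. Suc (xs ! 1) - triangle (Suc (xs ! 0)))"
    by (intro recursive_diff recursive_triangle recursive_Suc recursive_proj) auto
  moreover have "\<exists>t. Suc n - triangle (Suc t) = 0" for n
    by (rule exI[of _ n]) simp
  ultimately have "recursive 1 (\<lambda>xs. d (xs ! 0))"
    using recursive_Least[of 1 "\<lambda>xs. Suc (xs ! 1) - triangle (Suc (xs ! 0))"]
    unfolding d_def by simp
  then have rd: "recursive k (\<lambda>xs. d (f xs))"
    using assms by (rule recursive_comp1)
  have n: "n = triangle (d n) + fst (prod_decode n)" for n
    using prod_decode_inverse[of n] unfolding d by (cases "prod_decode n") (simp add: prod_encode_def)
  have fst: "n - triangle (d n) = fst (prod_decode n)" for n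
    using n[of n] by linarith
  have snd: "d n - (n - triangle (d n)) = snd (prod_decode n)" for n
    unfolding fst by (simp add: d)
  have "recursive k (\<lambda>xs. f xs - triangle (d (f xs)))"
    by (intro recursive_diff recursive_triangle rd assms)
  then show "recursive k (\<lambda>xs. fst (prod_decode (f xs)))"
    unfolding fst .
  have "recursive k (\<lambda>xs. d (f xs) - (f xs - triangle (d (f xs))))"
    by (intro recursive_diff recursive_triangle rd assms)
  then show "recursive k (\<lambda>xs. snd (prod_decode (f xs)))"
    unfolding snd .
qed

section \<open>Computable functions on pairs and lists\<close>

text \<open>The coding is a bijection, so every number is the code of an argument and a set of numbers
  is given by a predicate on the type. The instances agree with the codes that the decision
  problems use.\<close>

class coded =
  fixes enc :: "'a \<Rightarrow> nat" and dec :: "nat \<Rightarrow> 'a"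
  assumes dec_enc [simp]: "dec (enc x) = x" and enc_dec [simp]: "enc (dec n) = n"

instantiation nat :: coded
begin
definition enc_nat :: "nat \<Rightarrow> nat" where [simp]: "enc_nat n = n"
definition dec_nat :: "nat \<Rightarrow> nat" where [simp]: "dec_nat n = n"
instance by standard auto
end

instantiation prod :: (coded, coded) coded
begin
definition enc_prod :: "'a \<times> 'b \<Rightarrow> nat" where "enc_prod x = prod_encode (map_prod enc enc x)"
definition dec_prod :: "nat \<Rightarrow> 'a \<times> 'b" where "dec_prod n = map_prod dec dec (prod_decode n)"
instance by standard (auto simp: enc_prod_def dec_prod_def prod.map_comp prod.map_ident comp_def)
end

instantiation list :: (coded) coded
begin
definition enc_list :: "'a list \<Rightarrow> nat" where "enc_list xs = list_encode (map enc xs)"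
definition dec_list :: "nat \<Rightarrow> 'a list" where "dec_list n = map dec (list_decode n)"
instance by standard (auto simp: enc_list_def dec_list_def comp_def)
end

lemma enc_Pair: "enc (x, y) = prod_encode (enc x, enc y)"
  by (simp add: enc_prod_def)

lemma fst_dec: "fst (dec n) = dec (fst (prod_decode n))"
  and snd_dec: "snd (dec n) = dec (snd (prod_decode n))"
  by (simp_all add: dec_prod_def)

lemma enc_Nil: "enc [] = 0"
  by (simp add: enc_list_def)

lemma enc_Cons: "enc (x # xs) = Suc (enc (x, xs))"
  by (simp add: enc_list_def enc_prod_def)

lemma enc_eq_iff: "enc x = enc y \<longleftrightarrow> x = y"
  by (metis dec_enc)

definition computable :: "('a::coded \<Rightarrow> 'b::coded) \<Rightarrow> bool" where
  "computable f \<longleftrightarrow> recursive 1 (\<lambda>xs. enc (f (dec (xs ! 0))))"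

definition computable_pred :: "('a::coded \<Rightarrow> bool) \<Rightarrow> bool" where
  "computable_pred P \<longleftrightarrow> computable (\<lambda>x. if P x then 1 else 0 :: nat)"

named_theorems computable_intros

lemma computable_id [computable_intros]: "computable (\<lambda>x. x)"
  unfolding computable_def using recursive_proj[of 0 1] by simp

lemma computable_const [computable_intros]: "computable (\<lambda>_. c)"
  unfolding computable_def by (rule recursive_const)

lemma computable_comp:
  assumes "computable g" "computable f"
  shows "computable (\<lambda>x. g (f x))"
  using assms recursive_comp1[of "\<lambda>n. enc (g (dec n))" 1 "\<lambda>xs. enc (f (dec (xs ! 0)))"]
  unfolding computable_def by simp

lemma computable_fst [computable_intros]: "computable f \<Longrightarrow> computable (\<lambda>x. fst (f x))"
  and computable_snd [computable_intros]: "computable f \<Longrightarrow> computable (\<lambda>x. snd (f x))"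
  by (rule computable_comp[rotated], assumption,
      simp add: computable_def fst_dec snd_dec recursive_prod_decode recursive_proj)+

lemma computable_Pair [computable_intros]:
  "computable f \<Longrightarrow> computable g \<Longrightarrow> computable (\<lambda>x. (f x, g x))"
  unfolding computable_def enc_Pair by (rule recursive_prod_encode)

lemma computable_Suc [computable_intros]: "computable f \<Longrightarrow> computable (\<lambda>x. Suc (f x))"
  unfolding computable_def by (simp add: recursive_Suc)

lemma computable_add [computable_intros]:
  "computable f \<Longrightarrow> computable g \<Longrightarrow> computable (\<lambda>x. f x + g x :: nat)"
  unfolding computable_def by (simp add: recursive_add)

lemma computable_diff [computable_intros]:
  "computable f \<Longrightarrow> computable g \<Longrightarrow> computable (\<lambda>x. f x - g x :: nat)"
  unfolding computable_def by (simp add: recursive_diff)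

lemma computable_enc [computable_intros]: "computable f \<Longrightarrow> computable (\<lambda>x. enc (f x))"
  unfolding computable_def by simp

lemma computable_dec [computable_intros]: "computable f \<Longrightarrow> computable (\<lambda>x. dec (f x))"
  unfolding computable_def by simp

text \<open>In this rule and the following ones, the step function receives the parameter \<open>x\<close> along with
  its proper arguments. It is stated through projections of a tuple, so that the rules for \<^const>\<open>fst\<close>
  and \<^const>\<open>snd\<close> close the goals about bound variables.\<close>

lemma computable_rec_nat [computable_intros]:
  assumes n: "computable n" and a: "computable a"
    and g: "computable (\<lambda>z. g (fst z) (fst (snd z)) (snd (snd z)))"
  shows "computable (\<lambda>x. rec_nat (a x) (\<lambda>i y. g x i y) (n x))"
proof -
  let ?g = "\<lambda>n. enc ((\<lambda>z. g (fst z) (fst (snd z)) (snd (snd z))) (dec n))"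
  have step: "recursive (1 + 2) (\<lambda>xs. ?g (prod_encode (xs ! 2, prod_encode (xs ! 0, xs ! 1))))"
    using g unfolding computable_def
    by (rule recursive_comp1) (intro recursive_prod_encode recursive_proj; simp)
  have "rec_nat (enc (a x)) (\<lambda>i y. ?g (prod_encode (enc x, prod_encode (i, y)))) m =
    enc (rec_nat (a x) (\<lambda>i y. g x i y) m)" for x m
    by (induction m) (simp_all add: dec_prod_def)
  from this[of "dec c" for c]
  have "rec_nat (enc (a (dec c))) (\<lambda>i y. ?g (prod_encode (c, prod_encode (i, y)))) m =
    enc (rec_nat (a (dec c)) (\<lambda>i y. g (dec c) i y) m)" for c m
    by simp
  moreover have "recursive 1 (\<lambda>xs. n (dec (xs ! 0)))"
    using n unfolding computable_def by simp
  ultimately show ?thesis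
    using recursive_rec_nat[OF _ a[unfolded computable_def] step]
    unfolding computable_def by simp
qed

text \<open>The code of a nonempty list is the successor of the code of its head and tail, so one step
  of recursion on the code takes a list apart.\<close>

lemma computable_case_list [computable_intros]:
  fixes g :: "'a::coded \<Rightarrow> 'b::coded \<Rightarrow> 'b list \<Rightarrow> 'c::coded"
  assumes "computable l" "computable a" "computable (\<lambda>z. g (fst z) (fst (snd z)) (snd (snd z)))"
  shows "computable (\<lambda>x. case l x of [] \<Rightarrow> a x | y # ys \<Rightarrow> g x y ys)"
proof -
  let ?g = "\<lambda>x i. g x (fst (dec i :: 'b \<times> 'b list)) (snd (dec i :: 'b \<times> 'b list))"
  have "computable (\<lambda>z :: 'a \<times> nat \<times> 'c. ?g (fst z) (fst (snd z)))"
    by (rule computable_comp[OF assms(3), of "\<lambda>z. (fst z, dec (fst (snd z)))", simplified])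
      (intro computable_intros)
  then have "computable (\<lambda>x. rec_nat (a x) (\<lambda>i y. ?g x i) (enc (l x)))"
    by (intro computable_intros assms)
  moreover have "rec_nat (a x) (\<lambda>i y. ?g x i) (enc (l x)) =
    (case l x of [] \<Rightarrow> a x | y # ys \<Rightarrow> g x y ys)" for x
    by (cases "l x") (auto simp: enc_Nil enc_Cons)
  ultimately show ?thesis
    by simp
qed

lemma computable_Cons [computable_intros]:
  "computable f \<Longrightarrow> computable g \<Longrightarrow> computable (\<lambda>x. f x # g x)"
  unfolding computable_def enc_Cons enc_Pair by (intro recursive_Suc recursive_prod_encode)

lemma length_le_enc: "length xs \<le> enc xs"
  by (induction xs) (auto simp: enc_Cons enc_Nil enc_Pair intro: le_trans[OF _ le_prod_encode_2])

text \<open>Folding consumes one entry of the list in each step of an iteration. The code of the list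
  bounds its length, and further steps change nothing.\<close>

lemma computable_fold [computable_intros]:
  assumes l: "computable l" and a: "computable a"
    and g: "computable (\<lambda>z. g (fst z) (fst (snd z)) (snd (snd z)))"
  shows "computable (\<lambda>x. fold (\<lambda>y r. g x y r) (l x) (a x))"
proof -
  let ?step = "\<lambda>x s. case fst s of [] \<Rightarrow> s | y # ys \<Rightarrow> (ys, g x y (snd s))"
  have it: "rec_nat (ys, r) (\<lambda>i. ?step x) n = (drop n ys, fold (g x) (take n ys) r)" for x n ys r
  proof (induction n)
    case (Suc n)
    show ?case
    proof (cases "n < length ys")
      case True
      then have "drop n ys = ys ! n # drop (Suc n) ys" "take (Suc n) ys = take n ys @ [ys ! n]"
        by (simp_all add: Cons_nth_drop_Suc take_Suc_conv_app_nth)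
      with Suc show ?thesis
        by simp
    qed (use Suc in simp)
  qed simp
  have "computable (\<lambda>w. g (fst (fst w)) (fst (snd w)) (snd (snd (snd (fst w)))))"
    by (rule computable_comp[OF g,
          of "\<lambda>w. (fst (fst w), fst (snd w), snd (snd (snd (fst w))))", simplified])
      (intro computable_intros)
  then have "computable (\<lambda>x. snd (rec_nat (l x, a x) (\<lambda>i. ?step x) (enc (l x))))"
    by (intro computable_intros l a)
  then show ?thesis
    by (simp add: it length_le_enc)
qed

lemma computable_rev [computable_intros]:
  assumes "computable l"
  shows "computable (\<lambda>x. rev (l x))"
proof -
  have "computable (\<lambda>x. fold (\<lambda>y r. y # r) (l x) [])"
    by (intro computable_intros assms)
  then show ?thesis
    by (simp add: fold_Cons_rev)
qed

lemma computable_foldr [computable_intros]: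
  assumes "computable l" "computable a" "computable (\<lambda>z. g (fst z) (fst (snd z)) (snd (snd z)))"
  shows "computable (\<lambda>x. foldr (\<lambda>y r. g x y r) (l x) (a x))"
  unfolding foldr_conv_fold by (intro computable_intros assms)

lemma computable_append [computable_intros]:
  fixes f g :: "'a::coded \<Rightarrow> 'b::coded list"
  assumes "computable f" "computable g"
  shows "computable (\<lambda>x. f x @ g x)"
proof -
  have "computable (\<lambda>x. foldr (\<lambda>y r. y # r) (f x) (g x))"
    by (intro computable_intros assms)
  moreover have "foldr (\<lambda>y r. y # r) xs ys = xs @ ys" for xs ys :: "'b list"
    by (induction xs) auto
  ultimately show ?thesis
    by simp
qed

lemma computable_concat [computable_intros]:
  assumes "computable f"
  shows "computable (\<lambda>x. concat (f x))"
  unfolding concat_conv_foldr by (intro computable_intros assms)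

lemma computable_map [computable_intros]:
  fixes f :: "'a::coded \<Rightarrow> 'b::coded \<Rightarrow> 'c::coded"
  assumes l: "computable l" and f: "computable (\<lambda>z. f (fst z) (snd z))"
  shows "computable (\<lambda>x. map (\<lambda>y. f x y) (l x))"
proof -
  have "computable (\<lambda>z. f (fst z) (fst (snd z)))"
    by (rule computable_comp[OF f, of "\<lambda>z. (fst z, fst (snd z))", simplified]) (intro computable_intros)
  then have "computable (\<lambda>x. foldr (\<lambda>y r. f x y # r) (l x) [])"
    by (intro computable_intros l)
  moreover have "foldr (\<lambda>y r. h y # r) xs [] = map h xs" for h :: "'b \<Rightarrow> 'c" and xs
    by (induction xs) auto
  ultimately show ?thesis
    by simp
qed

lemma computable_length [computable_intros]:
  fixes l :: "'a::coded \<Rightarrow> 'b::coded list"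
  assumes "computable l"
  shows "computable (\<lambda>x. length (l x))"
proof -
  have "computable (\<lambda>x. foldr (\<lambda>y r. Suc r) (l x) 0)"
    by (intro computable_intros assms)
  moreover have "foldr (\<lambda>y r. Suc r) xs 0 = length xs" for xs :: "'b list"
    by (induction xs) auto
  ultimately show ?thesis
    by simp
qed

lemma computable_if [computable_intros]:
  assumes P: "computable_pred P" and f: "computable f" and g: "computable g"
  shows "computable (\<lambda>x. if P x then f x else g x)"
proof -
  have "computable (\<lambda>z. f (fst z))"
    by (rule computable_comp[OF f]) (intro computable_intros)
  then have "computable (\<lambda>x. rec_nat (g x) (\<lambda>i y. f x) (if P x then 1 else 0))"
    using P unfolding computable_pred_def by (intro computable_intros g)
  moreover have "rec_nat (g x) (\<lambda>i y. f x) (if P x then 1 else 0) = (if P x then f x else g x)" for x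
    by simp
  ultimately show ?thesis
    by simp
qed

lemma computable_pred_comp:
  assumes "computable_pred P" "computable f"
  shows "computable_pred (\<lambda>x. P (f x))"
  using assms unfolding computable_pred_def by (rule computable_comp)

lemma computable_pred_True: "computable_pred (\<lambda>x. True)"
  and computable_pred_False: "computable_pred (\<lambda>x. False)"
  unfolding computable_pred_def by (simp_all add: computable_const)

lemma computable_pred_if:
  assumes P: "computable_pred P" and f: "computable_pred Q" and g: "computable_pred R"
  shows "computable_pred (\<lambda>x. if P x then Q x else R x)"
proof -
  have "(if if P x then Q x else R x then 1 else 0 :: nat) =
    (if P x then if Q x then 1 else 0 else if R x then 1 else 0)" for x
    by simp
  with computable_if[OF P f[unfolded computable_pred_def] g[unfolded computable_pred_def]]
  show ?thesis
    unfolding computable_pred_def by presburger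
qed

lemma computable_pred_not [computable_intros]:
  assumes "computable_pred P"
  shows "computable_pred (\<lambda>x. \<not> P x)"
proof -
  have "(\<not> P x) = (if P x then False else True)" for x
    by simp
  with computable_pred_if[OF assms computable_pred_False computable_pred_True] show ?thesis
    by presburger
qed

lemma computable_pred_connectives [computable_intros]:
  assumes "computable_pred P" "computable_pred Q"
  shows "computable_pred (\<lambda>x. P x \<and> Q x)" "computable_pred (\<lambda>x. P x \<longrightarrow> Q x)"
proof -
  have "(P x \<and> Q x) = (if P x then Q x else False)" "(P x \<longrightarrow> Q x) = (if P x then Q x else True)" for x
    by simp_all
  with computable_pred_if[OF assms computable_pred_False]
    computable_pred_if[OF assms computable_pred_True]
  show "computable_pred (\<lambda>x. P x \<and> Q x)" "computable_pred (\<lambda>x. P x \<longrightarrow> Q x)"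
    by presburger+
qed

lemma computable_pred_eq [computable_intros]:
  fixes f g :: "'a::coded \<Rightarrow> 'b::coded"
  assumes "computable f" "computable g"
  shows "computable_pred (\<lambda>x. f x = g x)"
proof -
  have "computable (\<lambda>x. 1 - ((enc (f x) - enc (g x)) + (enc (g x) - enc (f x))))"
    by (intro computable_intros assms)
  moreover have "1 - ((m - n) + (n - m)) = (if m = n then 1 else 0)" for m n :: nat
    by auto
  ultimately show ?thesis
    unfolding computable_pred_def by (simp add: enc_eq_iff cong: if_cong)
qed

lemma computable_pred_less [computable_intros]:
  fixes f g :: "'a::coded \<Rightarrow> nat"
  assumes "computable f" "computable g"
  shows "computable_pred (\<lambda>x. f x < g x)"
proof -
  have "computable_pred (\<lambda>x. \<not> g x - f x = 0)"
    by (intro computable_intros assms)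
  then show ?thesis
    by (simp add: not_le)
qed

lemma computable_pred_bex [computable_intros]:
  fixes l :: "'a::coded \<Rightarrow> 'b::coded list"
  assumes l: "computable l" and P: "computable_pred (\<lambda>z. P (fst z) (snd z))"
  shows "computable_pred (\<lambda>x. \<exists>y\<in>set (l x). P x y)"
proof -
  have "computable_pred (\<lambda>z. P (fst z) (fst (snd z)))"
    by (rule computable_pred_comp[OF P, of "\<lambda>z. (fst z, fst (snd z))", simplified])
      (intro computable_intros)
  then have "computable (\<lambda>x. foldr (\<lambda>y r. if P x y then 1 else r) (l x) (0 :: nat))"
    by (intro computable_intros l)
  moreover have "foldr (\<lambda>y r. if Q y then 1 else r) xs (0 :: nat) = (if \<exists>y\<in>set xs. Q y then 1 else 0)"
    for Q and xs :: "'b list"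
    by (induction xs) (auto simp del: One_nat_def)
  ultimately show ?thesis
    unfolding computable_pred_def by simp
qed

lemma computable_pred_ball [computable_intros]:
  assumes l: "computable l" and P: "computable_pred (\<lambda>z. P (fst z) (snd z))"
  shows "computable_pred (\<lambda>x. \<forall>y\<in>set (l x). P x y)"
proof -
  have "computable_pred (\<lambda>x. \<not> (\<exists>y\<in>set (l x). \<not> P x y))"
    by (intro computable_intros l P)
  then show ?thesis
    by simp
qed

lemma computable_pred_member [computable_intros]:
  assumes "computable f" "computable l"
  shows "computable_pred (\<lambda>x. f x \<in> set (l x))"
proof -
  have "computable (\<lambda>z. f (fst z))"
    by (rule computable_comp[OF assms(1)]) (intro computable_intros)
  then have "computable_pred (\<lambda>x. \<exists>y\<in>set (l x). f x = y)"
    by (intro computable_intros assms)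
  then show ?thesis
    by simp
qed

lemma computable_filter [computable_intros]:
  fixes l :: "'a::coded \<Rightarrow> 'b::coded list"
  assumes l: "computable l" and P: "computable_pred (\<lambda>z. P (fst z) (snd z))"
  shows "computable (\<lambda>x. filter (\<lambda>y. P x y) (l x))"
proof -
  have "computable_pred (\<lambda>z. P (fst z) (fst (snd z)))"
    by (rule computable_pred_comp[OF P, of "\<lambda>z. (fst z, fst (snd z))", simplified])
      (intro computable_intros)
  then have "computable (\<lambda>x. foldr (\<lambda>y r. if P x y then y # r else r) (l x) [])"
    by (intro computable_intros l)
  moreover have "foldr (\<lambda>y r. if Q y then y # r else r) xs [] = filter Q xs" for Q and xs :: "'b list"
    by (induction xs) auto
  ultimately show ?thesis
    by simp
qed

lemma decidable_if_computable_pred: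
  fixes P :: "'a::coded \<Rightarrow> bool"
  assumes "computable_pred P" and "\<And>x. enc x \<in> S \<longleftrightarrow> P x"
  shows "decidable S"
proof -
  obtain p where "\<And>xs. length xs = 1 \<Longrightarrow> computes p xs (if P (dec (xs ! 0)) then 1 else 0)"
    using assms(1) unfolding computable_pred_def computable_def recursive_def by auto
  from this[of "[n]" for n] have "computes p [n] (if P (dec n) then 1 else 0)" for n
    by simp
  moreover have "P (dec n) \<longleftrightarrow> n \<in> S" for n
    using assms(2)[of "dec n"] by simp
  ultimately show ?thesis
    unfolding decidable_def by metis
qed

section \<open>Reduced words in a free group\<close>

text \<open>A letter is coded as in \<^const>\<open>letter_code\<close>, so formal inversion changes the parity.\<close>

definition flip :: "nat \<Rightarrow> nat" where
  "flip c = (if even c then Suc c else c - 1)"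

definition cons_red :: "nat \<Rightarrow> nat list \<Rightarrow> nat list" where
  "cons_red c w = (case w of [] \<Rightarrow> [c] | d # v \<Rightarrow> if d = flip c then v else c # w)"

definition mul_red :: "nat list \<Rightarrow> nat list \<Rightarrow> nat list" where
  "mul_red u v = foldr cons_red u v"

abbreviation reduced_codes :: "nat list \<Rightarrow> bool" where
  "reduced_codes \<equiv> successively (\<lambda>c d. d \<noteq> flip c)"

definition code_letter :: "nat \<Rightarrow> nat \<times> bool" where
  "code_letter c = (c div 2, odd c)"

lemma flip_flip [simp]: "flip (flip c) = c"
  by (auto simp: flip_def)

lemma flip_less: "c < 2 * k \<Longrightarrow> flip c < 2 * k"
  by (auto simp: flip_def elim!: evenE)

lemma flip_iff: "d = flip c \<longleftrightarrow> c div 2 = d div 2 \<and> odd c \<noteq> odd d"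
  unfolding flip_def by (cases "even c"; cases "even d"; auto elim!: evenE oddE; presburger)

lemma code_letter_letter_code [simp]: "code_letter (letter_code l) = l"
  by (cases l) (auto simp: code_letter_def letter_code_def)

lemma letter_code_code_letter [simp]: "letter_code (code_letter c) = c"
  by (auto simp: code_letter_def letter_code_def)

lemma reduced_codes_cons_red: "reduced_codes w \<Longrightarrow> reduced_codes (cons_red c w)"
  by (cases w) (auto simp: cons_red_def successively_Cons)

lemma set_cons_red: "set (cons_red c w) \<subseteq> insert c (set w)"
  by (cases w) (auto simp: cons_red_def)

lemma cons_red_eq_Cons: "reduced_codes (c # w) \<Longrightarrow> cons_red c w = c # w"
  by (cases w) (auto simp: cons_red_def)

lemma cons_red_flip: "reduced_codes w \<Longrightarrow> cons_red (flip c) (cons_red c w) = w"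
  by (cases w) (auto simp: cons_red_def successively_Cons split: list.splits)

text \<open>The letters are elements of a group with formal inverses among them. Relations between the
  letters are allowed here, so that the lemmas apply before the words are known to be unique.\<close>

locale group_letters = group G for G :: "('g, 'm) monoid_scheme" (structure) +
  fixes k :: nat and b :: "nat \<Rightarrow> 'g"
  assumes letter_closed: "c < k \<Longrightarrow> b c \<in> carrier G"
    and flip_closed: "c < k \<Longrightarrow> flip c < k"
    and letter_flip: "c < k \<Longrightarrow> b (flip c) = inv (b c)"
begin

definition val :: "nat list \<Rightarrow> 'g" where
  "val w = foldr (\<lambda>c g. b c \<otimes> g) w \<one>"

definition words :: "nat list set" where
  "words = {w. set w \<subseteq> {..<k} \<and> reduced_codes w}"

lemma val_Nil [simp]: "val [] = \<one>"
  and val_Cons [simp]: "val (c # w) = b c \<otimes> val w"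
  by (simp_all add: val_def)

lemma val_closed: "set w \<subseteq> {..<k} \<Longrightarrow> val w \<in> carrier G"
  by (induction w) (auto simp: letter_closed)

lemma val_append: "set u \<subseteq> {..<k} \<Longrightarrow> set v \<subseteq> {..<k} \<Longrightarrow> val (u @ v) = val u \<otimes> val v"
  by (induction u) (auto simp: letter_closed val_closed m_assoc)

lemma val_inv: "set w \<subseteq> {..<k} \<Longrightarrow> val (rev (map flip w)) = inv (val w)"
proof (induction w)
  case (Cons c w)
  then have "set (rev (map flip w)) \<subseteq> {..<k}" "set [flip c] \<subseteq> {..<k}"
    by (auto intro: flip_closed)
  then have "val (rev (map flip (c # w))) = val (rev (map flip w)) \<otimes> val [flip c]"
    using val_append by simp
  also have "\<dots> = inv (val (c # w))"
    using Cons by (simp add: letter_flip letter_closed val_closed inv_mult_group)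
  finally show ?case .
qed simp

lemma val_cons_red:
  assumes "c < k" "set w \<subseteq> {..<k}"
  shows "val (cons_red c w) = b c \<otimes> val w"
proof (cases "\<exists>v. w = flip c # v")
  case True
  then obtain v where w: "w = flip c # v"
    by blast
  with assms have "val v \<in> carrier G"
    by (auto intro: val_closed)
  then have "b c \<otimes> (inv (b c) \<otimes> val v) = val v"
    using assms(1) by (simp add: letter_closed flip: m_assoc)
  with w assms show ?thesis
    by (simp add: cons_red_def letter_flip)
qed (cases w; auto simp: cons_red_def)

lemma cons_red_words: "c < k \<Longrightarrow> w \<in> words \<Longrightarrow> cons_red c w \<in> words"
  using set_cons_red[of c w] by (auto simp: words_def reduced_codes_cons_red)

lemma mul_red_words:
  "set u \<subseteq> {..<k} \<Longrightarrow> v \<in> words \<Longrightarrow> mul_red u v \<in> words \<and> val (mul_red u v) = val u \<otimes> val v"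
proof (induction u)
  case Nil
  then show ?case
    by (simp add: mul_red_def words_def val_closed)
next
  case (Cons c u)
  then have IH: "mul_red u v \<in> words" "val (mul_red u v) = val u \<otimes> val v"
    by auto
  then have "val (cons_red c (mul_red u v)) = b c \<otimes> (val u \<otimes> val v)"
    using Cons.prems by (subst val_cons_red) (auto simp: words_def)
  moreover have "cons_red c (mul_red u v) \<in> words"
    using Cons.prems IH by (auto intro: cons_red_words)
  moreover have "val v \<in> carrier G" "val u \<in> carrier G" "b c \<in> carrier G"
    using Cons.prems by (auto simp: words_def letter_closed val_closed)
  ultimately show ?case
    by (simp add: mul_red_def m_assoc)
qed

lemma Nil_in_words: "[] \<in> words"
  by (simp add: words_def)

lemma words_tl: "c # w \<in> words \<Longrightarrow> w \<in> words"
  by (auto simp: words_def successively_Cons)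

end

text \<open>Here the letters are a basis and its inverses.\<close>

locale free_letters = group_letters +
  assumes val_bij: "bij_betw val words (carrier G)"
begin

definition word_of :: "'a \<Rightarrow> nat list" where
  "word_of = inv_into words val"

lemma word_of: "g \<in> carrier G \<Longrightarrow> word_of g \<in> words" "g \<in> carrier G \<Longrightarrow> val (word_of g) = g"
  using val_bij unfolding word_of_def bij_betw_def
  by (metis inv_into_into, metis f_inv_into_f)

lemma word_of_val: "w \<in> words \<Longrightarrow> word_of (val w) = w"
  using val_bij unfolding word_of_def bij_betw_def by simp

lemma word_of_mult:
  assumes "c < k" "g \<in> carrier G"
  shows "word_of (b c \<otimes> g) = cons_red c (word_of g)"
proof -
  have "val (cons_red c (word_of g)) = b c \<otimes> g"
    using val_cons_red[of c "word_of g"] word_of[of g] assms by (auto simp: words_def)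
  then show ?thesis
    using word_of_val cons_red_words word_of(1) assms by metis
qed

end

text \<open>The given basis may be infinite, but only finitely many of its elements occur in the reduced
  words of the generators. Words in these elements reach the whole group because the generators
  do, and reduced words remain distinct in the group because they are reduced words over the given
  basis.\<close>

lemma free_letters_exist:
  fixes G (structure)
  assumes "free_group G" and gs: "finite H" "H \<subseteq> carrier G" "generate G H = carrier G"
  obtains k b where "free_letters G k b"
proof -
  from assms(1) obtain B where "group G" and B: "free_basis G B"
    unfolding free_group_def by blast
  interpret group G by fact
  let ?ev = "word_value G (\<lambda>b. b)"
  have bij: "bij_betw ?ev {w \<in> lists (B \<times> UNIV). reduced w} (carrier G)" and BG: "B \<subseteq> carrier G"
    using B unfolding free_basis_def by auto
  then have "\<forall>g\<in>H. \<exists>w\<in>lists (B \<times> UNIV). ?ev w = g"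
    using gs(2) unfolding bij_betw_def by (smt (verit) image_iff mem_Collect_eq subset_iff)
  then obtain W where W: "\<And>g. g \<in> H \<Longrightarrow> W g \<in> lists (B \<times> UNIV)" "\<And>g. g \<in> H \<Longrightarrow> ?ev (W g) = g"
    by metis
  define B0 where "B0 = (\<Union>g\<in>H. fst ` set (W g))"
  have "finite B0"
    using gs(1) by (simp add: B0_def)
  then obtain bs where bs: "set bs = B0" "distinct bs"
    using finite_distinct_list by blast
  have "B0 \<subseteq> B"
    using W(1) by (fastforce simp: B0_def)
  then have bsB: "set bs \<subseteq> B" and bsG: "set bs \<subseteq> carrier G"
    using BG bs by auto
  define k where "k = 2 * length bs"
  define l where "l = (\<lambda>c. (bs ! (c div 2), odd c))"
  define b where "b = (\<lambda>c. letter_value G (\<lambda>b. b) (l c))"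
  have bs_nth: "bs ! (c div 2) \<in> set bs" if "c < k" for c
    using that by (auto simp: k_def)
  interpret group_letters G k b
  proof unfold_locales
    fix c
    assume c: "c < k"
    have "bs ! (c div 2) \<in> carrier G"
      using bs_nth[OF c] bsG by auto
    moreover have "flip c div 2 = c div 2" "odd (flip c) \<longleftrightarrow> even c"
      using flip_iff[of "flip c" c] by auto
    ultimately show "b c \<in> carrier G" "b (flip c) = inv b c"
      by (auto simp: b_def l_def letter_value_def)
    show "flip c < k"
      using c unfolding k_def by (rule flip_less)
  qed
  have b: "letter_value G (\<lambda>b. b) (l c) = b c" for c
    by (simp add: b_def)
  have ev: "?ev (map l w) = val w" for w
    by (induction w) (simp_all add: word_value_def b)
  have l_inj: "inj_on l {..<k}"
  proof (rule inj_onI)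
    fix c d
    assume "c \<in> {..<k}" "d \<in> {..<k}" "l c = l d"
    then have "c div 2 = d div 2" "odd c = odd d"
      using bs(2) by (auto simp: l_def k_def nth_eq_iff_index_eq)
    then show "c = d"
      by (metis bit_eq_rec)
  qed
  have l_onto: "(x, s) \<in> l ` {..<k}" if x: "x \<in> set bs" for x s
  proof -
    obtain i where "i < length bs" "x = bs ! i"
      using x by (metis in_set_conv_nth)
    then have "l (2 * i + (if s then 1 else 0)) = (x, s)" "2 * i + (if s then 1 else 0) < k"
      by (auto simp: l_def k_def)
    then show ?thesis
      by (metis imageI lessThan_iff)
  qed
  have reduced: "map l w \<in> {w \<in> lists (B \<times> UNIV). reduced w}" if w: "w \<in> words" for w
  proof -
    have "set (map l w) \<subseteq> B \<times> UNIV"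
      using w bs_nth bsB by (fastforce simp: words_def l_def)
    moreover have "reduced (map l w)"
      unfolding reduced_def successively_map
    proof (rule successively_mono)
      show "reduced_codes w"
        using w by (simp add: words_def)
      fix c d
      assume "c \<in> set w" "d \<in> set w" and d: "d \<noteq> flip c"
      then have "c < k" "d < k"
        using w by (auto simp: words_def)
      then show "\<not> (fst (l c) = fst (l d) \<and> snd (l c) \<noteq> snd (l d))"
        using d bs(2) by (auto simp: flip_iff l_def k_def nth_eq_iff_index_eq)
    qed
    ultimately show ?thesis
      by (auto simp: lists_eq_set)
  qed
  have "inj_on val words"
  proof (rule inj_onI)
    fix u v
    assume uv: "u \<in> words" "v \<in> words" "val u = val v"
    have "?ev (map l u) = ?ev (map l v)"
      unfolding ev by (rule uv(3))
    then have "map l u = map l v"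
      by (rule inj_onD[OF bij_betw_imp_inj_on[OF bij]]) (intro reduced uv)+
    moreover have "inj_on l (set u \<union> set v)"
      using uv by (intro inj_on_subset[OF l_inj]) (auto simp: words_def)
    ultimately show "u = v"
      by (metis inj_on_map_eq_map)
  qed
  moreover have "val ` words = carrier G"
  proof
    show "val ` words \<subseteq> carrier G"
      using val_closed by (auto simp: words_def)
    have gens: "\<exists>w. set w \<subseteq> {..<k} \<and> val w = g" if g: "g \<in> H" for g
    proof -
      have W_l: "x \<in> l ` {..<k}" if "x \<in> set (W g)" for x
        using that g l_onto[of "fst x" "snd x"] bs(1) by (auto simp: B0_def)
      have "map l (map (inv_into {..<k} l) (W g)) = W g"
        by (simp add: map_idI W_l f_inv_into_f)
      moreover have "set (map (inv_into {..<k} l) (W g)) \<subseteq> {..<k}"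
        using inv_into_into[OF W_l] by auto
      ultimately show ?thesis
        using W(2)[OF g] ev by metis
    qed
    have "\<exists>w. set w \<subseteq> {..<k} \<and> val w = g" if "g \<in> generate G H" for g
      using that
    proof induction
      case one
      show ?case
        by (rule exI[of _ "[]"]) simp
    next
      case (incl g)
      show ?case
        using incl by (rule gens)
    next
      case (inv g)
      then obtain w where "set w \<subseteq> {..<k}" "val w = g"
        using gens by blast
      then have "val (rev (map flip w)) = inv g" "set (rev (map flip w)) \<subseteq> {..<k}"
        using val_inv by (auto intro: flip_closed)
      then show ?case
        by blast
    next
      case (eng g h)
      then obtain u v where "set u \<subseteq> {..<k}" "val u = g" "set v \<subseteq> {..<k}" "val v = h"
        by blast
      then show ?case
        using val_append[of u v] by (intro exI[of _ "u @ v"]) auto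
    qed
    then have all: "\<exists>w. set w \<subseteq> {..<k} \<and> val w = g" if "g \<in> carrier G" for g
      using that gs(3) by blast
    show "carrier G \<subseteq> val ` words"
    proof
      fix g
      assume "g \<in> carrier G"
      with all obtain w where w: "set w \<subseteq> {..<k}" "val w = g"
        by blast
      then have "mul_red w [] \<in> words" "val (mul_red w []) = g"
        using mul_red_words[OF w(1) Nil_in_words] val_closed[OF w(1)] by simp_all
      then show "g \<in> val ` words"
        by blast
    qed
  qed
  ultimately have "free_letters G k b"
    by unfold_locales (simp add: bij_betw_def)
  then show thesis
    by (rule that)
qed

section \<open>The extension algorithm\<close>

type_synonym coded_pattern = "(nat list \<times> nat) list"

text \<open>The default \<open>d\<close> is the value at missing keys. It is never reached when a colouring is read
  on its support or a word over the generators is translated.\<close>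

definition lookup :: "'b \<Rightarrow> ('a \<times> 'b) list \<Rightarrow> 'a \<Rightarrow> 'b" where
  "lookup d ps a = foldr (\<lambda>e r. if fst e = a then snd e else r) ps d"

primrec tails :: "'a list \<Rightarrow> 'a list list" where
  "tails [] = [[]]"
| "tails (x # xs) = (x # xs) # tails xs"

text \<open>The set \<open>B\<close> on which the colourings live. Walking along a word from its first letter on
  leaves a suffix of it to be read, so all suffixes belong to the set.\<close>

definition support :: "coded_pattern list \<Rightarrow> nat list list" where
  "support qs = [] # concat (map (\<lambda>e. tails (fst e)) (concat qs))"

definition colourings :: "nat \<Rightarrow> nat list list \<Rightarrow> coded_pattern list" where
  "colourings m B = foldr (\<lambda>h r. concat (map (\<lambda>p. map (\<lambda>i. (h, i) # p) [0..<m]) r)) B [[]]"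

definition fits :: "coded_pattern \<Rightarrow> coded_pattern \<Rightarrow> bool" where
  "fits q p \<longleftrightarrow> (\<forall>e\<in>set q. lookup 0 p (fst e) = snd e)"

text \<open>Here \<open>p\<close> is the colouring seen at some \<open>g\<close> and \<open>q\<close> the one seen at \<open>g c\<close>.\<close>

definition matches :: "nat list list \<Rightarrow> nat \<Rightarrow> coded_pattern \<Rightarrow> coded_pattern \<Rightarrow> bool" where
  "matches B c p q \<longleftrightarrow>
    (\<forall>h\<in>set B. cons_red c h \<in> set B \<longrightarrow> lookup 0 p (cons_red c h) = lookup 0 q h)"

definition refine :: "nat \<Rightarrow> nat list list \<Rightarrow> coded_pattern list \<Rightarrow> coded_pattern list" where
  "refine k B S = filter (\<lambda>p. \<forall>c\<in>set [0..<k]. \<exists>q\<in>set S. matches B c p q) S"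

text \<open>The length of the list bounds the number of refinements that delete something.\<close>

definition stabilize :: "nat \<Rightarrow> nat list list \<Rightarrow> coded_pattern list \<Rightarrow> coded_pattern list" where
  "stabilize k B S = rec_nat S (\<lambda>_. refine k B) (length S)"

definition legal :: "nat \<Rightarrow> nat list list \<Rightarrow> coded_pattern list \<Rightarrow> coded_pattern list" where
  "legal m B qs = filter (\<lambda>p. \<forall>q\<in>set qs. \<not> fits q p) (colourings m B)"

definition extendable :: "nat \<Rightarrow> nat \<Rightarrow> coded_pattern list \<Rightarrow> coded_pattern \<Rightarrow> bool" where
  "extendable k m qs q \<longleftrightarrow>
    (\<exists>p\<in>set (stabilize k (support (q # qs)) (legal m (support (q # qs)) qs)). fits q p)"

lemma self_in_tails: "xs \<in> set (tails xs)"
  by (cases xs) auto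

lemma tails_closed: "x # xs \<in> set (tails ys) \<Longrightarrow> xs \<in> set (tails ys)"
  by (induction ys) (auto simp: self_in_tails)

lemma Nil_in_support: "[] \<in> set (support qs)"
  by (simp add: support_def)

lemma tl_in_support: "c # w \<in> set (support qs) \<Longrightarrow> w \<in> set (support qs)"
  by (auto simp: support_def dest: tails_closed)

lemma fst_in_support: "q \<in> set qs \<Longrightarrow> e \<in> set q \<Longrightarrow> fst e \<in> set (support qs)"
  unfolding support_def using self_in_tails by fastforce

lemma lookup_map:
  "h \<in> set B \<Longrightarrow> lookup d (map (\<lambda>h. (h, f h)) B) h = f h"
  by (induction B) (auto simp: lookup_def)

lemma graph_in_colourings:
  "(\<And>h. h \<in> set B \<Longrightarrow> f h < m) \<Longrightarrow> map (\<lambda>h. (h, f h)) B \<in> set (colourings m B)"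
proof (induction B)
  case (Cons a B)
  then have "map (\<lambda>h. (h, f h)) B \<in> set (colourings m B)" "f a < m"
    by auto
  then show ?case
    unfolding colourings_def by force
qed (simp add: colourings_def)

lemma lookup_colourings:
  "p \<in> set (colourings m B) \<Longrightarrow> h \<in> set B \<Longrightarrow> lookup 0 p h < m"
  by (induction B arbitrary: p) (auto simp: colourings_def lookup_def)

lemma refine_subset: "set (refine k B S) \<subseteq> set S"
  by (auto simp: refine_def)

lemma stabilize_subset: "set (stabilize k B S) \<subseteq> set S"
proof -
  have "set (rec_nat S (\<lambda>_. refine k B) n) \<subseteq> set S" for n
    by (induction n) (use refine_subset in fastforce)+
  then show ?thesis
    by (simp add: stabilize_def)
qed

text \<open>A refinement that changes anything shortens the list, so the changes end after as many steps
  as the list has entries.\<close>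

lemma refine_stabilize: "refine k B (stabilize k B S) = stabilize k B S"
proof -
  let ?S = "rec_nat S (\<lambda>_. refine k B)"
  have shorter: "length (refine k B T) < length T" if "refine k B T \<noteq> T" for T
    using that unfolding refine_def filter_id_conv by (auto intro: length_filter_less)
  have "refine k B (?S n) = ?S n \<or> length (?S n) + n \<le> length S" for n
  proof (induction n)
    case (Suc n)
    show ?case
    proof (cases "refine k B (?S n) = ?S n")
      case False
      with Suc shorter[of "?S n"] show ?thesis
        by simp
    qed simp
  qed simp
  from this[of "length S"] show ?thesis
    unfolding stabilize_def by (auto simp: refine_def)
qed

text \<open>A set in which all members have their neighbours loses no member in any refinement, so the
  iteration stops at the greatest such set.\<close>

lemma stabilize_greatest:
  assumes "T \<subseteq> set S" and "\<And>p c. p \<in> T \<Longrightarrow> c < k \<Longrightarrow> \<exists>q\<in>T. matches B c p q"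
  shows "T \<subseteq> set (stabilize k B S)"
proof -
  have "T \<subseteq> set (rec_nat S (\<lambda>_. refine k B) n)" for n
  proof (induction n)
    case (Suc n)
    then show ?case
      using assms(2) by (fastforce simp: refine_def)
  qed (simp add: assms(1))
  then show ?thesis
    by (simp add: stabilize_def)
qed

text \<open>The overlap is the same seen from both ends of an edge. This makes the choice of neighbours
  along the edges of the tree consistent in both directions.\<close>

lemma matches_flip:
  assumes "\<And>h. h \<in> set B \<Longrightarrow> reduced_codes h" "matches B c p q"
  shows "matches B (flip c) q p"
  using assms cons_red_flip[of _ "flip c"] unfolding matches_def by fastforce

context free_letters
begin

definition fits_at :: "coded_pattern \<Rightarrow> ('a \<Rightarrow> nat) \<Rightarrow> 'a \<Rightarrow> bool" where
  "fits_at q x g \<longleftrightarrow> (\<forall>e\<in>set q. x (g \<otimes> val (fst e)) = snd e)"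

lemma support_words:
  assumes "\<And>q e. q \<in> set qs \<Longrightarrow> e \<in> set q \<Longrightarrow> fst e \<in> words"
  shows "set (support qs) \<subseteq> words"
proof -
  have "set (tails w) \<subseteq> words" if "w \<in> words" for w
    using that by (induction w) (auto simp: Nil_in_words dest: words_tl)
  then show ?thesis
    using assms by (fastforce simp: support_def Nil_in_words)
qed

text \<open>The colourings that \<open>x\<close> shows at the elements of the group provide each other's neighbours,
  so no refinement deletes them.\<close>

lemma extendable_if_occurs:
  assumes words: "\<And>q' e. q' \<in> set (q # qs) \<Longrightarrow> e \<in> set q' \<Longrightarrow> fst e \<in> words"
    and x: "\<And>g. g \<in> carrier G \<Longrightarrow> x g < m"
    and avoid: "\<And>q' g. q' \<in> set qs \<Longrightarrow> g \<in> carrier G \<Longrightarrow> \<not> fits_at q' x g"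
    and g0: "s \<in> carrier G" "fits_at q x s"
  shows "extendable k m qs q"
proof -
  let ?B = "support (q # qs)"
  let ?st = "\<lambda>g. map (\<lambda>h. (h, x (g \<otimes> val h))) ?B"
  have B: "set ?B \<subseteq> words"
    using words by (rule support_words)
  then have val: "val h \<in> carrier G" if "h \<in> set ?B" for h
    using that val_closed by (auto simp: words_def)
  have fits: "fits q' (?st g) \<longleftrightarrow> fits_at q' x g" if "q' \<in> set (q # qs)" for q' g
    unfolding fits_def fits_at_def
    using fst_in_support[OF that] lookup_map[of _ ?B 0 "\<lambda>h. x (g \<otimes> val h)"] by auto
  have "?st ` carrier G \<subseteq> set (stabilize k ?B (legal m ?B qs))"
  proof (rule stabilize_greatest)
    show "?st ` carrier G \<subseteq> set (legal m ?B qs)"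
      using fits avoid by (auto simp: legal_def val intro!: graph_in_colourings x)
    fix p c
    assume "p \<in> ?st ` carrier G" and c: "c < k"
    then obtain g where g: "g \<in> carrier G" and p: "p = ?st g"
      by blast
    have "matches ?B c (?st g) (?st (g \<otimes> b c))"
      unfolding matches_def
    proof (intro ballI impI)
      fix h
      assume h: "h \<in> set ?B" "cons_red c h \<in> set ?B"
      then have "val (cons_red c h) = b c \<otimes> val h"
        using B c by (intro val_cons_red) (auto simp: words_def)
      then show "lookup 0 (?st g) (cons_red c h) = lookup 0 (?st (g \<otimes> b c)) h"
        using g c h val by (simp add: lookup_map m_assoc letter_closed)
    qed
    then show "\<exists>q'\<in>?st ` carrier G. matches ?B c p q'"
      unfolding p using g c letter_closed by blast
  qed
  then show ?thesis
    unfolding extendable_def using g0 fits by auto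
qed

text \<open>A configuration is unfolded from the surviving colourings by choices along the tree of
  reduced words.\<close>

lemma occurs_if_extendable:
  assumes words: "\<And>q' e. q' \<in> set (q # qs) \<Longrightarrow> e \<in> set q' \<Longrightarrow> fst e \<in> words"
    and ext: "extendable k m qs q"
  shows "\<exists>x. (\<forall>g\<in>carrier G. x g < m) \<and>
    (\<forall>q'\<in>set qs. \<forall>g\<in>carrier G. \<not> fits_at q' x g) \<and> fits_at q x \<one>"
proof -
  let ?B = "support (q # qs)"
  define S where "S = stabilize k ?B (legal m ?B qs)"
  have B: "set ?B \<subseteq> words"
    using words by (rule support_words)
  obtain p0 where p0: "p0 \<in> set S" "fits q p0"
    using ext unfolding extendable_def S_def by blast
  have S: "set S \<subseteq> set (legal m ?B qs)"
    unfolding S_def by (rule stabilize_subset)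
  have "refine k ?B S = S"
    unfolding S_def by (rule refine_stabilize)
  then have closed: "\<exists>p'. p' \<in> set S \<and> matches ?B c p p'" if "p \<in> set S" "c < k" for p c
  proof -
    have "c \<in> set [0..<k]"
      using that(2) by simp
    with that(1) show ?thesis
      using \<open>refine k ?B S = S\<close> unfolding refine_def filter_id_conv by blast
  qed
  define nx where "nx = (\<lambda>c p. SOME p'. p' \<in> set S \<and> matches ?B c p p')"
  have nx: "nx c p \<in> set S" "matches ?B c p (nx c p)" if "p \<in> set S" "c < k" for p c
    using someI_ex[OF closed[OF that]] unfolding nx_def by blast+
  (* T w is the colouring chosen at the inverse of the value of w. With inverses, a step from g to
     g c changes the word at its head, where cons_red acts. *)
  define T where "T = (\<lambda>w. foldr (\<lambda>c p. nx (flip c) p) w p0)"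
  have T_S: "T w \<in> set S" if "set w \<subseteq> {..<k}" for w
    using that by (induction w) (auto simp: T_def p0 nx flip_closed)
  have T_matches: "matches ?B c (T w) (T (cons_red (flip c) w))" if w: "w \<in> words" and c: "c < k" for w c
  proof (cases "\<exists>v. w = c # v")
    (* The step leads back to the parent, from which T w was chosen. *)
    case True
    then obtain v where v: "w = c # v"
      by blast
    with w have "T v \<in> set S"
      by (intro T_S) (auto simp: words_def)
    then have "matches ?B (flip c) (T v) (T w)"
      using nx(2) c flip_closed by (simp add: v T_def)
    then have "matches ?B (flip (flip c)) (T w) (T v)"
      by (rule matches_flip[rotated]) (use B in \<open>auto simp: words_def\<close>)
    then show ?thesis
      by (simp add: v cons_red_def)
  next
    case False
    then have "cons_red (flip c) w = flip c # w"
      by (auto simp: cons_red_def split: list.splits)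
    moreover have "T w \<in> set S"
      using w by (intro T_S) (auto simp: words_def)
    ultimately show ?thesis
      using nx(2) c by (simp add: T_def)
  qed
  define st where "st = (\<lambda>g. T (word_of (inv g)))"
  define x where "x = (\<lambda>g. lookup 0 (st g) [])"
  have st_S: "st g \<in> set S" if "g \<in> carrier G" for g
    unfolding st_def using word_of(1)[of "inv g"] that by (intro T_S) (auto simp: words_def)
  (* The colouring chosen at g is the one that x shows there. A letter of h is traded for a step in
     the tree; the rest of h is still in the support. *)
  have read: "lookup 0 (st g) h = x (g \<otimes> val h)" if "h \<in> set ?B" "g \<in> carrier G" for h g
    using that
  proof (induction h arbitrary: g)
    case Nil
    then show ?case
      by (simp add: x_def)
  next
    case (Cons c h)
    have ch: "c # h \<in> words" and h: "h \<in> set ?B"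
      using Cons.prems B tl_in_support by auto
    then have c: "c < k" and red: "cons_red c h = c # h" and val: "val h \<in> carrier G"
      by (auto simp: words_def cons_red_eq_Cons intro: val_closed)
    have "word_of (inv (g \<otimes> b c)) = cons_red (flip c) (word_of (inv g))"
      using word_of_mult[of "flip c" "inv g"] c Cons.prems(2)
      by (simp add: flip_closed letter_flip letter_closed inv_mult_group)
    then have "matches ?B c (st g) (st (g \<otimes> b c))"
      using T_matches[of "word_of (inv g)" c] c Cons.prems(2) by (simp add: st_def word_of)
    then have "lookup 0 (st g) (c # h) = lookup 0 (st (g \<otimes> b c)) h"
      using h red Cons.prems(1) unfolding matches_def by metis
    also have "\<dots> = x (g \<otimes> b c \<otimes> val h)"
      using Cons.IH h Cons.prems(2) c letter_closed by simp
    finally show ?case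
      using Cons.prems(2) c val by (simp add: letter_closed m_assoc)
  qed
  have fits: "fits_at q' x g \<longleftrightarrow> fits q' (st g)" if "q' \<in> set (q # qs)" "g \<in> carrier G" for q' g
    unfolding fits_at_def fits_def using fst_in_support[OF that(1)] read[OF _ that(2)] by simp
  show ?thesis
  proof (intro exI conjI ballI)
    show "x g < m" if "g \<in> carrier G" for g
      unfolding x_def using S st_S[OF that]
      by (intro lookup_colourings[of _ m ?B]) (auto simp: legal_def Nil_in_support)
    show "\<not> fits_at q' x g" if "q' \<in> set qs" "g \<in> carrier G" for q' g
      using S st_S[OF that(2)] fits[OF _ that(2), of q'] that(1) by (auto simp: legal_def)
    have "st \<one> = p0"
      using word_of_val[OF Nil_in_words] by (simp add: st_def T_def)
    then show "fits_at q x \<one>"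
      using fits[of q \<one>] p0 by simp
  qed
qed

end

section \<open>Computability of the algorithm\<close>

lemma computable_lookup [computable_intros]:
  fixes f :: "'a::coded \<Rightarrow> ('b::coded \<times> 'c::coded) list"
  assumes "computable d" "computable f" "computable g"
  shows "computable (\<lambda>x. lookup (d x) (f x) (g x))"
proof -
  have "computable (\<lambda>z :: 'c \<times> ('b \<times> 'c) list \<times> 'b. lookup (fst z) (fst (snd z)) (snd (snd z)))"
    unfolding lookup_def by (intro computable_intros)
  from computable_comp[OF this, of "\<lambda>x. (d x, f x, g x)"] assms show ?thesis
    by (simp add: computable_Pair)
qed

text \<open>The parity is a primitive recursion that alternates between 0 and 1.\<close>

lemma computable_flip [computable_intros]:
  assumes "computable f"
  shows "computable (\<lambda>x. flip (f x))"
proof -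
  have "rec_nat 0 (\<lambda>i r. 1 - r) n = n mod 2" for n :: nat
    by (induction n) (auto simp: mod_Suc)
  then have "flip n = (if rec_nat 0 (\<lambda>i r. 1 - r) n = (0::nat) then Suc n else n - 1)" for n
    by (auto simp: flip_def even_iff_mod_2_eq_zero)
  moreover have "computable (\<lambda>n. if rec_nat 0 (\<lambda>i r. 1 - r) n = (0::nat) then Suc n else n - 1)"
    by (intro computable_intros)
  ultimately have "computable flip"
    by presburger
  then show ?thesis
    using assms by (rule computable_comp)
qed

lemma computable_cons_red [computable_intros]:
  assumes "computable f" "computable g"
  shows "computable (\<lambda>x. cons_red (f x) (g x))"
proof -
  have "computable (\<lambda>z. cons_red (fst z) (snd z))"
    unfolding cons_red_def by (intro computable_intros)
  from computable_comp[OF this computable_Pair[OF assms]] show ?thesis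
    by simp
qed

lemma computable_mul_red [computable_intros]:
  assumes "computable f" "computable g"
  shows "computable (\<lambda>x. mul_red (f x) (g x))"
  unfolding mul_red_def by (intro computable_intros assms)

text \<open>The recursion builds each list anew next to its tails.\<close>

lemma computable_tails [computable_intros]:
  assumes "computable f"
  shows "computable (\<lambda>x. tails (f x))"
proof -
  have "foldr (\<lambda>y r. (y # fst r, (y # fst r) # snd r)) ys ([], [[]]) = (ys, tails ys)" for ys :: "'b list"
    by (induction ys) auto
  then have "tails ys = snd (foldr (\<lambda>y r. (y # fst r, (y # fst r) # snd r)) ys ([], [[]]))" for ys :: "'b list"
    by simp
  then show ?thesis
    by (simp only:) (intro computable_intros assms)
qed

lemma computable_support [computable_intros]:
  assumes "computable f"
  shows "computable (\<lambda>x. support (f x))"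
  unfolding support_def by (intro computable_intros assms)

lemma computable_colourings [computable_intros]:
  assumes "computable f"
  shows "computable (\<lambda>x. colourings m (f x))"
  unfolding colourings_def by (intro computable_intros assms)

lemma computable_pred_fits [computable_intros]:
  assumes "computable f" "computable g"
  shows "computable_pred (\<lambda>x. fits (f x) (g x))"
proof -
  have "computable_pred (\<lambda>z. fits (fst z) (snd z))"
    unfolding fits_def by (intro computable_intros)
  from computable_pred_comp[OF this computable_Pair[OF assms]] show ?thesis
    by simp
qed

lemma computable_pred_matches [computable_intros]:
  assumes "computable f" "computable c" "computable g" "computable h"
  shows "computable_pred (\<lambda>x. matches (f x) (c x) (g x) (h x))"
proof -
  have "computable_pred (\<lambda>z. matches (fst z) (fst (snd z)) (fst (snd (snd z))) (snd (snd (snd z))))"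
    unfolding matches_def by (intro computable_intros)
  from computable_pred_comp[OF this, of "\<lambda>x. (f x, c x, g x, h x)"] assms show ?thesis
    by (simp add: computable_Pair)
qed

lemma computable_refine [computable_intros]:
  assumes "computable f" "computable g"
  shows "computable (\<lambda>x. refine k (f x) (g x))"
proof -
  have "computable (\<lambda>z. refine k (fst z) (snd z))"
    unfolding refine_def by (intro computable_intros)
  from computable_comp[OF this computable_Pair[OF assms]] show ?thesis
    by simp
qed

lemma computable_stabilize [computable_intros]:
  assumes "computable f" "computable g"
  shows "computable (\<lambda>x. stabilize k (f x) (g x))"
proof -
  have "computable (\<lambda>z. stabilize k (fst z) (snd z))"
    unfolding stabilize_def by (intro computable_intros)
  from computable_comp[OF this computable_Pair[OF assms]] show ?thesis
    by simp
qed

lemma computable_legal [computable_intros]: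
  assumes "computable f" "computable g"
  shows "computable (\<lambda>x. legal m (f x) (g x))"
proof -
  have "computable (\<lambda>z. legal m (fst z) (snd z))"
    unfolding legal_def by (intro computable_intros)
  from computable_comp[OF this computable_Pair[OF assms]] show ?thesis
    by simp
qed

lemma computable_pred_extendable [computable_intros]:
  assumes "computable f" "computable g"
  shows "computable_pred (\<lambda>x. extendable k m (f x) (g x))"
proof -
  have "computable_pred (\<lambda>z. extendable k m (fst z) (snd z))"
    unfolding extendable_def by (intro computable_intros)
  from computable_pred_comp[OF this computable_Pair[OF assms]] show ?thesis
    by simp
qed

section \<open>Presentations of patterns\<close>

definition decode_word :: "nat list \<Rightarrow> nat word" where
  "decode_word w = map code_letter w"

definition decode_pattern :: "coded_pattern \<Rightarrow> pattern_pres" where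
  "decode_pattern p = map (\<lambda>e. (decode_word (fst e), snd e)) p"

definition valid :: "nat \<Rightarrow> nat \<Rightarrow> coded_pattern \<Rightarrow> bool" where
  "valid n m p \<longleftrightarrow> (\<forall>e\<in>set p. (\<forall>c\<in>set (fst e). c < n) \<and> snd e < m)"

definition functional :: "coded_pattern \<Rightarrow> bool" where
  "functional p \<longleftrightarrow> (\<forall>e\<in>set p. \<forall>e'\<in>set p. fst e = fst e' \<longrightarrow> snd e = snd e')"

text \<open>The table assigns to the code of a letter over the generators its reduced word in the
  basis.\<close>

definition translate :: "(nat \<times> nat list) list \<Rightarrow> nat list \<Rightarrow> nat list" where
  "translate tab w = foldr (\<lambda>c r. mul_red (lookup [] tab c) r) w []"

definition normalize :: "(nat \<times> nat list) list \<Rightarrow> coded_pattern \<Rightarrow> coded_pattern" where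
  "normalize tab p = map (\<lambda>e. (translate tab (fst e), snd e)) p"

definition presentable :: "(nat \<times> nat list) list \<Rightarrow> nat \<Rightarrow> nat \<Rightarrow> coded_pattern \<Rightarrow> bool" where
  "presentable tab n m p \<longleftrightarrow> valid n m p \<and> functional (normalize tab p)"

lemma map_letter_code_decode_word: "map letter_code (decode_word w) = w"
  by (simp add: decode_word_def comp_def)

lemma pattern_code_decode_pattern: "pattern_code (decode_pattern p) = enc p"
proof -
  have "word_code (decode_word w) = enc w" for w
    by (simp add: word_code_def map_letter_code_decode_word enc_list_def map_idI)
  then show ?thesis
    by (simp add: pattern_code_def decode_pattern_def enc_list_def[of p] enc_prod_def
        list_encode_eq case_prod_beta map_prod_def comp_def)
qed

lemma patterns_code_decode_pattern: "patterns_code (map decode_pattern ps) = enc ps"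
  by (simp add: patterns_code_def enc_list_def[of ps] pattern_code_decode_pattern comp_def)

lemma decode_pattern_onto: "\<exists>q. p = decode_pattern q"
proof
  show "p = decode_pattern (map (\<lambda>e. (map letter_code (fst e), snd e)) p)"
    by (simp add: decode_pattern_def decode_word_def comp_def)
qed

lemma patterns_onto: "\<exists>qs. ps = map decode_pattern qs"
  using decode_pattern_onto ex_map_conv by metis

lemma computable_pred_presentable [computable_intros]:
  assumes "computable f"
  shows "computable_pred (\<lambda>x. presentable tab n m (f x))"
proof -
  have "computable_pred (\<lambda>x. presentable tab n m x)"
    unfolding presentable_def valid_def functional_def normalize_def translate_def
    by (intro computable_intros)
  then show ?thesis
    using assms by (rule computable_pred_comp)
qed

lemma computable_normalize [computable_intros]:
  assumes "computable f"
  shows "computable (\<lambda>x. normalize tab (f x))"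
proof -
  have "computable (\<lambda>x. normalize tab x)"
    unfolding normalize_def translate_def by (intro computable_intros)
  then show ?thesis
    using assms by (rule computable_comp)
qed

text \<open>The data that the two decision procedures have built in: the basis, the generators with
  their table, and the alphabet.\<close>

locale presented_free_group = free_letters G k b
  for G :: "('g, 'm) monoid_scheme" (structure) and k b +
  fixes gs :: "'g list" and A :: "'a set" and syms :: "'a list" and tab :: "(nat \<times> nat list) list"
  assumes syms: "distinct syms" "set syms = A"
    and tab: "c < 2 * length gs \<Longrightarrow> lookup [] tab c \<in> words"
      "c < 2 * length gs \<Longrightarrow> val (lookup [] tab c) = letter_value G ((!) gs) (code_letter c)"
begin

lemma translate:
  assumes "\<And>c. c \<in> set w \<Longrightarrow> c < 2 * length gs"
  shows "translate tab w \<in> words \<and> val (translate tab w) = word_value G ((!) gs) (decode_word w)"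
  using assms
proof (induction w)
  case Nil
  then show ?case
    by (simp add: translate_def Nil_in_words word_value_def decode_word_def)
next
  case (Cons c w)
  then have IH: "translate tab w \<in> words"
    "val (translate tab w) = word_value G ((!) gs) (decode_word w)" and c: "c < 2 * length gs"
    by auto
  have "set (lookup [] tab c) \<subseteq> {..<k}"
    using tab(1)[OF c] by (auto simp: words_def)
  from mul_red_words[OF this IH(1)] IH(2) tab(2)[OF c] show ?case
    by (simp add: translate_def word_value_def decode_word_def)
qed

abbreviation nrm :: "coded_pattern \<Rightarrow> coded_pattern" where
  "nrm \<equiv> normalize tab"

abbreviation ok :: "coded_pattern \<Rightarrow> bool" where
  "ok \<equiv> presentable tab (2 * length gs) (length syms)"

lemma nrm_words:
  assumes "valid (2 * length gs) (length syms) p" "e \<in> set (nrm p)"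
  shows "fst e \<in> words" "snd e < length syms"
  using assms translate by (auto simp: valid_def normalize_def)

lemma valid_iff:
  "valid (2 * length gs) m p \<longleftrightarrow>
    (\<forall>(w, i)\<in>set (decode_pattern p). w \<in> lists ({..<length gs} \<times> UNIV) \<and> i < m)"
proof -
  have "c div 2 < n \<longleftrightarrow> c < 2 * n" for c n :: nat
    by auto
  then show ?thesis
    by (force simp: valid_def decode_pattern_def decode_word_def code_letter_def lists_eq_set)
qed

lemma presents_iff:
  "presents G gs syms (decode_pattern p) P \<longleftrightarrow> valid (2 * length gs) (length syms) p \<and>
    Map.graph P = (\<lambda>e. (val (fst e), syms ! snd e)) ` set (nrm p)"
proof (cases "valid (2 * length gs) (length syms) p")
  case True
  then have "(\<lambda>(w, i). (word_value G ((!) gs) w, syms ! i)) ` set (decode_pattern p) =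
    (\<lambda>e. (val (fst e), syms ! snd e)) ` set (nrm p)"
    using translate by (force simp: valid_def decode_pattern_def normalize_def image_image)
  with True show ?thesis
    unfolding presents_def using valid_iff[of "length syms" p] by simp
next
  case False
  then show ?thesis
    unfolding presents_def using valid_iff[of "length syms" p] by blast
qed

text \<open>Equal reduced words have equal values, and the symbols of the alphabet are listed without
  repetition, so a functional graph forces equal indices.\<close>

lemma presents_functional:
  assumes "presents G gs syms (decode_pattern p) P"
  shows "ok p"
proof -
  have v: "valid (2 * length gs) (length syms) p"
    and gr: "Map.graph P = (\<lambda>e. (val (fst e), syms ! snd e)) ` set (nrm p)"
    using assms by (auto simp: presents_iff)
  have "snd e = snd e'" if "e \<in> set (nrm p)" "e' \<in> set (nrm p)" "fst e = fst e'" for e e'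
  proof -
    have "(val (fst e), syms ! snd e) \<in> Map.graph P" "(val (fst e), syms ! snd e') \<in> Map.graph P"
      using imageI[OF that(1), of "\<lambda>e. (val (fst e), syms ! snd e)"]
        imageI[OF that(2), of "\<lambda>e. (val (fst e), syms ! snd e)"] that(3)
      unfolding gr by simp_all
    then have "syms ! snd e = syms ! snd e'"
      by (auto simp: Map.graph_def)
    then show ?thesis
      using nrm_words(2)[OF v that(1)] nrm_words(2)[OF v that(2)] syms(1)
      by (simp add: nth_eq_iff_index_eq)
  qed
  with v show ?thesis
    unfolding presentable_def functional_def by blast
qed

text \<open>Different reduced words have different values, so functionality on reduced words is
  functionality on group elements.\<close>

lemma presents_exists:
  assumes "ok p"
  shows "\<exists>P. presents G gs syms (decode_pattern p) P"
proof -
  have v: "valid (2 * length gs) (length syms) p" and f: "functional (nrm p)"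
    using assms by (auto simp: presentable_def)
  define R where "R = (\<lambda>e. (val (fst e), syms ! snd e)) ` set (nrm p)"
  define P where "P = (\<lambda>g. if \<exists>a. (g, a) \<in> R then Some (SOME a. (g, a) \<in> R) else None)"
  have uniq: "a = a'" if "(g, a) \<in> R" "(g, a') \<in> R" for g a a'
  proof -
    from that obtain e e' where e: "e \<in> set (nrm p)" "e' \<in> set (nrm p)"
      "val (fst e) = val (fst e')" "a = syms ! snd e" "a' = syms ! snd e'"
      by (auto simp: R_def)
    have "fst e = fst e'"
      using inj_onD[OF bij_betw_imp_inj_on[OF val_bij] e(3)] nrm_words(1)[OF v] e(1,2) by blast
    have "snd e = snd e'"
      by (rule f[unfolded functional_def, rule_format]) fact+
    with e(4,5) show ?thesis
      by simp
  qed
  have "P g = Some a \<longleftrightarrow> (g, a) \<in> R" for g a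
  proof (cases "\<exists>a. (g, a) \<in> R")
    case True
    then have "(g, SOME a. (g, a) \<in> R) \<in> R"
      by (rule someI_ex)
    then have "(SOME a. (g, a) \<in> R) = a \<longleftrightarrow> (g, a) \<in> R"
      using uniq by blast
    with True show ?thesis
      by (simp add: P_def)
  qed (simp add: P_def)
  then have "Map.graph P = R"
    unfolding Map.graph_def by auto
  with v show ?thesis
    by (auto simp: presents_iff R_def)
qed

lemma presents_Some:
  assumes "presents G gs syms (decode_pattern p) P"
  shows "P g = Some a \<longleftrightarrow> (\<exists>e\<in>set (nrm p). g = val (fst e) \<and> a = syms ! snd e)"
proof -
  have "P g = Some a \<longleftrightarrow> (g, a) \<in> Map.graph P"
    by (simp add: Map.graph_def)
  also have "\<dots> \<longleftrightarrow> (\<exists>e\<in>set (nrm p). g = val (fst e) \<and> a = syms ! snd e)"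
    using assms unfolding presents_iff by auto
  finally show ?thesis .
qed

lemma presents_pattern:
  assumes "presents G gs syms (decode_pattern p) P"
  shows "pattern G A P"
proof -
  have v: "valid (2 * length gs) (length syms) p"
    using assms by (simp add: presents_iff)
  have "dom P = (\<lambda>e. val (fst e)) ` set (nrm p)"
    by (auto simp: dom_def presents_Some[OF assms])
  moreover have "val (fst e) \<in> carrier G" "syms ! snd e \<in> A" if "e \<in> set (nrm p)" for e
    using nrm_words[OF v that] val_closed syms(2) by (auto simp: words_def)
  ultimately show ?thesis
    by (auto simp: pattern_def ran_def presents_Some[OF assms])
qed

lemma presents_occurs:
  assumes P: "presents G gs syms (decode_pattern p) P"
    and x: "\<And>g. g \<in> carrier G \<Longrightarrow> x g = syms ! y g" "\<And>g. g \<in> carrier G \<Longrightarrow> y g < length syms"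
  shows "occurs G P x \<longleftrightarrow> (\<exists>g\<in>carrier G. fits_at (nrm p) y g)"
proof -
  have v: "valid (2 * length gs) (length syms) p"
    using P by (simp add: presents_iff)
  have "(\<forall>h\<in>dom P. P h = Some (x (g \<otimes> h))) \<longleftrightarrow> fits_at (nrm p) y g" if g: "g \<in> carrier G" for g
  proof -
    have "(\<forall>h\<in>dom P. P h = Some (x (g \<otimes> h))) \<longleftrightarrow> (\<forall>h a. P h = Some a \<longrightarrow> a = x (g \<otimes> h))"
      by force
    also have "\<dots> \<longleftrightarrow> (\<forall>e\<in>set (nrm p). syms ! snd e = x (g \<otimes> val (fst e)))"
      unfolding presents_Some[OF P] by blast
    also have "\<dots> \<longleftrightarrow> fits_at (nrm p) y g"
      unfolding fits_at_def
    proof (rule ball_cong[OF refl])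
      fix e
      assume e: "e \<in> set (nrm p)"
      then have "g \<otimes> val (fst e) \<in> carrier G"
        using g nrm_words[OF v e] val_closed by (auto simp: words_def)
      then show "syms ! snd e = x (g \<otimes> val (fst e)) \<longleftrightarrow> y (g \<otimes> val (fst e)) = snd e"
        using x nrm_words(2)[OF v e] syms(1) by (auto simp: nth_eq_iff_index_eq)
    qed
    finally show ?thesis .
  qed
  then show ?thesis
    unfolding occurs_def by blast
qed

text \<open>Correctness of the algorithm for patterns as they are presented. Configurations over the
  alphabet correspond to configurations of symbol indices.\<close>

lemma occurs_in_SFT_iff_extendable:
  assumes Fs: "list_all2 (presents G gs syms) (map decode_pattern fs) Fs"
    and P: "presents G gs syms (decode_pattern p) P"
  shows "(\<exists>x\<in>SFT G A (set Fs). occurs G P x) \<longleftrightarrow> extendable k (length syms) (map nrm fs) (nrm p)"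
proof -
  have F: "length Fs = length fs"
    "\<And>i. i < length fs \<Longrightarrow> presents G gs syms (decode_pattern (fs ! i)) (Fs ! i)"
    using Fs by (auto simp: list_all2_conv_all_nth)
  have fs_Fs: "\<exists>F\<in>set Fs. presents G gs syms (decode_pattern f) F" if "f \<in> set fs" for f
    using that F by (metis in_set_conv_nth)
  have Fs_fs: "\<exists>f\<in>set fs. presents G gs syms (decode_pattern f) F" if "F \<in> set Fs" for F
    using that F by (metis in_set_conv_nth)
  have words: "fst e \<in> words" if "q \<in> set (nrm p # map nrm fs)" "e \<in> set q" for q e
  proof -
    have "q = nrm p \<or> (\<exists>f\<in>set fs. q = nrm f)"
      using that(1) by auto
    with P fs_Fs obtain r Q where "q = nrm r" "presents G gs syms (decode_pattern r) Q"
      by blast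
    with that(2) show ?thesis
      using nrm_words(1) presents_iff by metis
  qed
  show ?thesis
  proof
    assume "\<exists>x\<in>SFT G A (set Fs). occurs G P x"
    then obtain x where x: "x \<in> carrier G \<rightarrow>\<^sub>E A" "\<And>F. F \<in> set Fs \<Longrightarrow> \<not> occurs G F x" "occurs G P x"
      by (auto simp: SFT_def)
    have "\<exists>i<length syms. x g = syms ! i" if "g \<in> carrier G" for g
      using x(1) that syms(2) by (metis PiE_mem in_set_conv_nth)
    then obtain y where y: "\<And>g. g \<in> carrier G \<Longrightarrow> x g = syms ! y g"
      "\<And>g. g \<in> carrier G \<Longrightarrow> y g < length syms"
      by metis
    have "occurs G P x \<longleftrightarrow> (\<exists>g\<in>carrier G. fits_at (nrm p) y g)"
      by (intro presents_occurs P y)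
    with x(3) obtain g where g: "g \<in> carrier G" "fits_at (nrm p) y g"
      by blast
    have avoid: "\<not> fits_at q y g" if q: "q \<in> set (map nrm fs)" and g: "g \<in> carrier G" for q g
    proof -
      obtain f where f: "q = nrm f" "f \<in> set fs"
        using q by auto
      then obtain F where F: "F \<in> set Fs" "presents G gs syms (decode_pattern f) F"
        using fs_Fs by blast
      then have "occurs G F x \<longleftrightarrow> (\<exists>g\<in>carrier G. fits_at (nrm f) y g)"
        by (intro presents_occurs y)
      then show ?thesis
        using x(2)[OF F(1)] g f(1) by blast
    qed
    show "extendable k (length syms) (map nrm fs) (nrm p)"
      by (rule extendable_if_occurs[where x = y and s = g]) (fact words y(2) avoid g)+
  next
    assume ext: "extendable k (length syms) (map nrm fs) (nrm p)"
    have "\<exists>y. (\<forall>g\<in>carrier G. y g < length syms) \<and>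
      (\<forall>q\<in>set (map nrm fs). \<forall>g\<in>carrier G. \<not> fits_at q y g) \<and> fits_at (nrm p) y \<one>"
      by (rule occurs_if_extendable) (fact words ext)+
    then obtain y
      where y: "\<And>g. g \<in> carrier G \<Longrightarrow> y g < length syms"
        "\<And>q g. q \<in> set (map nrm fs) \<Longrightarrow> g \<in> carrier G \<Longrightarrow> \<not> fits_at q y g" "fits_at (nrm p) y \<one>"
      by blast
    define x where "x = restrict (\<lambda>g. syms ! y g) (carrier G)"
    have x: "x g = syms ! y g" if "g \<in> carrier G" for g
      using that by (simp add: x_def)
    have occ: "occurs G F x \<longleftrightarrow> (\<exists>g\<in>carrier G. fits_at (nrm f) y g)"
      if "presents G gs syms (decode_pattern f) F" for f F
      using that by (rule presents_occurs) (fact x y(1))+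
    have "occurs G P x"
      unfolding occ[OF P] using y(3) one_closed by blast
    moreover have "\<not> occurs G F x" if F: "F \<in> set Fs" for F
    proof -
      obtain f where f: "f \<in> set fs" "presents G gs syms (decode_pattern f) F"
        using Fs_fs[OF F] by blast
      then show ?thesis
        unfolding occ[OF f(2)] using y(2)[of "nrm f"] by simp
    qed
    moreover have "x \<in> carrier G \<rightarrow>\<^sub>E A"
      using y(1) syms(2) by (auto simp: x_def)
    ultimately show "\<exists>x\<in>SFT G A (set Fs). occurs G P x"
      by (auto simp: SFT_def)
  qed
qed

lemma list_all2_presents:
  "(\<exists>Fs. list_all2 (presents G gs syms) (map decode_pattern fs) Fs) \<longleftrightarrow> (\<forall>f\<in>set fs. ok f)"
proof
  assume "\<exists>Fs. list_all2 (presents G gs syms) (map decode_pattern fs) Fs"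
  then show "\<forall>f\<in>set fs. ok f"
    using presents_functional by (fastforce simp: list_all2_conv_all_nth in_set_conv_nth)
next
  assume "\<forall>f\<in>set fs. ok f"
  then have "list_all2 (presents G gs syms) (map decode_pattern fs)
    (map (\<lambda>f. SOME F. presents G gs syms (decode_pattern f) F) fs)"
    by (simp add: list_all2_conv_all_nth someI_ex[OF presents_exists])
  then show "\<exists>Fs. list_all2 (presents G gs syms) (map decode_pattern fs) Fs"
    by blast
qed

section \<open>The decision problems\<close>

lemma language_problem_iff:
  "enc (fs, p) \<in> language_problem G A gs syms \<longleftrightarrow>
    (\<forall>f\<in>set fs. ok f) \<and> ok p \<and> extendable k (length syms) (map nrm fs) (nrm p)"
proof
  assume "enc (fs, p) \<in> language_problem G A gs syms"
  then obtain fs' p' Fs P where *: "enc (fs, p) = prod_encode (patterns_code fs', pattern_code p')"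
    "list_all2 (presents G gs syms) fs' Fs" "presents G gs syms p' P"
    "P \<in> language G A (SFT G A (set Fs))"
    unfolding language_problem_def by blast
  obtain gs' q where q: "fs' = map decode_pattern gs'" "p' = decode_pattern q"
    using patterns_onto decode_pattern_onto by metis
  have "gs' = fs" "q = p"
    using *(1) unfolding q patterns_code_decode_pattern pattern_code_decode_pattern enc_Pair
    by (simp_all add: enc_eq_iff)
  then show "(\<forall>f\<in>set fs. ok f) \<and> ok p \<and> extendable k (length syms) (map nrm fs) (nrm p)"
    using *(2-4) occurs_in_SFT_iff_extendable list_all2_presents presents_functional
    unfolding q language_def by blast
next
  assume *: "(\<forall>f\<in>set fs. ok f) \<and> ok p \<and> extendable k (length syms) (map nrm fs) (nrm p)"
  then obtain Fs P where FP: "list_all2 (presents G gs syms) (map decode_pattern fs) Fs"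
    "presents G gs syms (decode_pattern p) P"
    using list_all2_presents presents_exists by blast
  then have "P \<in> language G A (SFT G A (set Fs))"
    unfolding language_def using * occurs_in_SFT_iff_extendable presents_pattern by blast
  moreover have "enc (fs, p) =
    prod_encode (patterns_code (map decode_pattern fs), pattern_code (decode_pattern p))"
    by (simp add: enc_Pair patterns_code_decode_pattern pattern_code_decode_pattern)
  ultimately show "enc (fs, p) \<in> language_problem G A gs syms"
    unfolding language_problem_def using FP by blast
qed

text \<open>A configuration of the first SFT is outside the second if and only if a forbidden pattern of
  the second occurs in it.\<close>

lemma SFT_subset_iff:
  assumes Fs: "list_all2 (presents G gs syms) (map decode_pattern fs) Fs"
    and Hs: "list_all2 (presents G gs syms) (map decode_pattern hs) Hs"
  shows "SFT G A (set Fs) \<subseteq> SFT G A (set Hs) \<longleftrightarrow>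
    (\<forall>h\<in>set hs. \<not> extendable k (length syms) (map nrm fs) (nrm h))"
proof -
  have "SFT G A (set Fs) \<subseteq> SFT G A (set Hs) \<longleftrightarrow>
    (\<forall>H\<in>set Hs. \<not> (\<exists>x\<in>SFT G A (set Fs). occurs G H x))"
    by (auto simp: SFT_def)
  also have "\<dots> \<longleftrightarrow> (\<forall>i<length hs. \<not> (\<exists>x\<in>SFT G A (set Fs). occurs G (Hs ! i) x))"
    using list_all2_lengthD[OF Hs] by (auto simp: all_set_conv_all_nth)
  also have "\<dots> \<longleftrightarrow> (\<forall>i<length hs. \<not> extendable k (length syms) (map nrm fs) (nrm (hs ! i)))"
  proof -
    have "(\<exists>x\<in>SFT G A (set Fs). occurs G (Hs ! i) x) \<longleftrightarrow>
      extendable k (length syms) (map nrm fs) (nrm (hs ! i))" if "i < length hs" for i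
      by (rule occurs_in_SFT_iff_extendable[OF Fs])
        (use Hs that in \<open>simp add: list_all2_conv_all_nth\<close>)
    then show ?thesis
      by simp
  qed
  finally show ?thesis
    by (simp add: all_set_conv_all_nth)
qed

lemma inclusion_problem_iff:
  "enc (fs, hs) \<in> inclusion_problem G A gs syms \<longleftrightarrow>
    (\<forall>f\<in>set fs. ok f) \<and> (\<forall>h\<in>set hs. ok h) \<and>
    (\<forall>h\<in>set hs. \<not> extendable k (length syms) (map nrm fs) (nrm h))"
proof
  assume "enc (fs, hs) \<in> inclusion_problem G A gs syms"
  then obtain fs' hs' Fs Hs where *: "enc (fs, hs) = prod_encode (patterns_code fs', patterns_code hs')"
    "list_all2 (presents G gs syms) fs' Fs" "list_all2 (presents G gs syms) hs' Hs"
    "SFT G A (set Fs) \<subseteq> SFT G A (set Hs)"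
    unfolding inclusion_problem_def by blast
  obtain qs rs where q: "fs' = map decode_pattern qs" "hs' = map decode_pattern rs"
    using patterns_onto by metis
  have "qs = fs" "rs = hs"
    using *(1) by (simp_all add: q enc_Pair patterns_code_decode_pattern enc_eq_iff)
  then show "(\<forall>f\<in>set fs. ok f) \<and> (\<forall>h\<in>set hs. ok h) \<and>
    (\<forall>h\<in>set hs. \<not> extendable k (length syms) (map nrm fs) (nrm h))"
    using *(2-4) SFT_subset_iff list_all2_presents unfolding q by blast
next
  assume *: "(\<forall>f\<in>set fs. ok f) \<and> (\<forall>h\<in>set hs. ok h) \<and>
    (\<forall>h\<in>set hs. \<not> extendable k (length syms) (map nrm fs) (nrm h))"
  then obtain Fs Hs where FH: "list_all2 (presents G gs syms) (map decode_pattern fs) Fs"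
    "list_all2 (presents G gs syms) (map decode_pattern hs) Hs"
    using list_all2_presents by blast
  then have "SFT G A (set Fs) \<subseteq> SFT G A (set Hs)"
    using * SFT_subset_iff by blast
  moreover have "enc (fs, hs) =
    prod_encode (patterns_code (map decode_pattern fs), patterns_code (map decode_pattern hs))"
    by (simp add: enc_Pair patterns_code_decode_pattern)
  ultimately show "enc (fs, hs) \<in> inclusion_problem G A gs syms"
    unfolding inclusion_problem_def using FH by blast
qed

lemma decidable_language_problem: "decidable (language_problem G A gs syms)"
proof (rule decidable_if_computable_pred)
  show "computable_pred (\<lambda>z. (\<forall>f\<in>set (fst z). ok f) \<and> ok (snd z) \<and>
    extendable k (length syms) (map nrm (fst z)) (nrm (snd z)))"
    by (intro computable_intros)
qed (auto simp: language_problem_iff)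

lemma decidable_inclusion_problem: "decidable (inclusion_problem G A gs syms)"
proof (rule decidable_if_computable_pred)
  show "computable_pred (\<lambda>z. (\<forall>f\<in>set (fst z). ok f) \<and> (\<forall>h\<in>set (snd z). ok h) \<and>
    (\<forall>h\<in>set (snd z). \<not> extendable k (length syms) (map nrm (fst z)) (nrm h)))"
    by (intro computable_intros)
qed (auto simp: inclusion_problem_iff)

end

theorem theorem8p10:
  fixes G :: "('g, 'm) monoid_scheme" and gs :: "'g list"
    and A :: "'a set" and syms :: "'a list"
  assumes "free_group G"
    and "set gs \<subseteq> carrier G" and "generate G (set gs) = carrier G"
    and "finite A" and "distinct syms" and "set syms = A"
  shows "decidable (language_problem G A gs syms) \<and> decidable (inclusion_problem G A gs syms)"
proof -
  obtain k b where "free_letters G k b"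
    using free_letters_exist[OF assms(1) _ assms(2,3)] by blast
  then interpret free_letters G k b .
  define tab where
    "tab = map (\<lambda>c. (c, word_of (letter_value G ((!) gs) (code_letter c)))) [0..<2 * length gs]"
  have "letter_value G ((!) gs) (code_letter c) \<in> carrier G" if "c < 2 * length gs" for c
  proof -
    have "gs ! (c div 2) \<in> carrier G"
      using that assms(2) by (intro subsetD[OF assms(2)] nth_mem) simp
    then show ?thesis
      by (simp add: letter_value_def code_letter_def)
  qed
  moreover have "lookup [] tab c = word_of (letter_value G ((!) gs) (code_letter c))"
    if "c < 2 * length gs" for c
    unfolding tab_def using that by (intro lookup_map) simp
  ultimately interpret presented_free_group G k b gs A syms tab
    using assms by unfold_locales (simp_all add: word_of)
  show ?thesis
    using decidable_language_problem decidable_inclusion_problem by blast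
qed

end
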